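(* For $1\le i\le i+m\le n-1$ and all $k_1,\dots,k_m,p\in\mathbb C$, $f^{(k_1,\dots,k_m)}_{i\cdots i+m}*f^{(k_1+p,\dots,k_m+p)}_{i\cdots i+m}=f^{(k_1+p,\dots,k_m+p)}_{i\cdots i+m}*f^{(k_1,\dots,k_m)}_{i\cdots i+m}$.
   Context: Fix an integer $n\ge2$, an integer $r>0$, a real $0<x<1$ and a complex parameter $\delta$. Let $[u]=x^{u^2/r-u}\Theta_{x^{2r}}(x^{2u})$, $\Theta_q(z)=(z;q)_\infty(q/z;q)_\infty(q;q)_\infty$. A function of type $(a_1,\dots,a_{n-1})$ ($a_j\in\mathbb Z_{\ge0}$) is a function of variables $u^{(b)}_j$ ($1\le j\le n-1$, $1\le b\le a_j$) and $\kappa_1,\dots,\kappa_{n-1}$, symmetric in $(u^{(1)}_j,\dots,u^{(a_j)}_j)$ for each $j$. For $f$ of type $(a_j)$ and $g$ of type $(b_j)$, $f*g$ is the function of type $(a_j+b_j)$ in variables $u^{(\cdot)}_j,v^{(\cdot)}_j$: $(f*g)=S\Big(f(u;\kappa_1+(b_0-2b_1+b_2)\delta,\dots,\kappa_{n-1}+(b_{n-2}-2b_{n-1}+b_n)\delta)\,g(v;\kappa)\prod_{j,a\le a_j,b\le b_j}\frac{[u^{(a)}_j-v^{(b)}_j-\delta]}{[u^{(a)}_j-v^{(b)}_j]}\prod_{1\le j\le n-2,a\le a_j,b\le b_{j+1}}\frac{[u^{(a)}_j-v^{(b)}_{j+1}+\frac\delta2]}{[u^{(a)}_j-v^{(b)}_{j+1}]}\prod_{2\le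 j\le n-1,a\le a_j,b\le b_{j-1}}\frac{[u^{(a)}_j-v^{(b)}_{j-1}+\frac\delta2]}{[u^{(a)}_j-v^{(b)}_{j-1}]}\Big)$, with $b_0=b_n=0$, where $S$ is the average over all permutations of $(u^{(1)}_j,\dots,u^{(a_j)}_j,v^{(1)}_j,\dots,v^{(b_j)}_j)$, independently for each $j$. For $1\le i\le i+m\le n-1$ and $k_1,\dots,k_m\in\mathbb C$ (with $k_0=-1$, $k_{m+1}=0$), $f^{(k_1,\dots,k_m)}_{i\cdots i+m}$ is the function of type $(a_j)$ with $a_j=1$ for $i\le j\le i+m$ and $0$ otherwise, given by $\prod_{j=1}^m\frac{[u_{i+j-1}-u_{i+j}-(k_j+\frac12)\delta]}{[u_{i+j-1}-u_{i+j}]}\prod_{j=0}^m[u_{i+j}-(k_j-k_{j+1}+\frac12)\delta-\kappa_{i+j}]$ (for $m=0$ this is $[u_i+\frac\delta2-\kappa_i]$). Equalities are identities of meromorphic functions. *)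

theory Defs
  imports "HOL-Analysis.Analysis" "HOL-Combinatorics.Permutations"
begin

definition qpoch :: "complex \<Rightarrow> complex \<Rightarrow> complex" where
  "qpoch z q = (\<Prod>k. (1 - z * q ^ k))"

definition Theta :: "complex \<Rightarrow> complex \<Rightarrow> complex" where
  "Theta q z = qpoch z q * qpoch (q / z) q * qpoch q q"

definition cpow_real :: "real \<Rightarrow> complex \<Rightarrow> complex" where
  "cpow_real x c = exp (c * complex_of_real (ln x))"

definition brk :: "real \<Rightarrow> nat \<Rightarrow> complex \<Rightarrow> complex" where
  "brk x r u = cpow_real x (u^2 / of_nat r - u) *
               Theta (complex_of_real (x ^ (2 * r))) (cpow_real x (2 * u))"

(* A function of type (a_1..a_{n-1}) is represented as a map
   F w \<kappa>, where w j b = u_j^{(b)} (1 \<le> j \<le> n-1, 1 \<le> b \<le> a_j) and \<kappa> j = \<kappa>_j. *)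
type_synonym fn = "(nat \<Rightarrow> nat \<Rightarrow> complex) \<Rightarrow> (nat \<Rightarrow> complex) \<Rightarrow> complex"

definition perm_fams :: "nat \<Rightarrow> (nat \<Rightarrow> nat) \<Rightarrow> (nat \<Rightarrow> nat \<Rightarrow> nat) set" where
  "perm_fams n c = {\<sigma>. \<forall>j. (j \<in> {1..n-1} \<longrightarrow> \<sigma> j permutes {1..c j}) \<and>
                          (j \<notin> {1..n-1} \<longrightarrow> \<sigma> j = id)}"

definition bz :: "nat \<Rightarrow> (nat \<Rightarrow> nat) \<Rightarrow> nat \<Rightarrow> nat" where
  "bz n b j = (if 1 \<le> j \<and> j \<le> n - 1 then b j else 0)"

definition star_term :: "nat \<Rightarrow> real \<Rightarrow> nat \<Rightarrow> complex \<Rightarrow> (nat \<Rightarrow> nat) \<Rightarrow> (nat \<Rightarrow> nat) \<Rightarrow>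
    fn \<Rightarrow> fn \<Rightarrow> (nat \<Rightarrow> nat \<Rightarrow> complex) \<Rightarrow> (nat \<Rightarrow> nat \<Rightarrow> complex) \<Rightarrow> (nat \<Rightarrow> complex) \<Rightarrow> complex" where
  "star_term n x r \<delta> a b f g U V \<kappa> =
     f U (\<lambda>j. if j \<in> {1..n-1}
               then \<kappa> j + (of_nat (bz n b (j - 1)) - 2 * of_nat (bz n b j) + of_nat (bz n b (j + 1))) * \<delta>
               else \<kappa> j)
   * g V \<kappa>
   * (\<Prod>j\<in>{1..n-1}. \<Prod>c\<in>{1..a j}. \<Prod>d\<in>{1..b j}.
        brk x r (U j c - V j d - \<delta>) / brk x r (U j c - V j d))
   * (\<Prod>j\<in>{1..n-2}. \<Prod>c\<in>{1..a j}. \<Prod>d\<in>{1..b (j + 1)}.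
        brk x r (U j c - V (j + 1) d + \<delta> / 2) / brk x r (U j c - V (j + 1) d))
   * (\<Prod>j\<in>{2..n-1}. \<Prod>c\<in>{1..a j}. \<Prod>d\<in>{1..b (j - 1)}.
        brk x r (U j c - V (j - 1) d + \<delta> / 2) / brk x r (U j c - V (j - 1) d))"

definition star :: "nat \<Rightarrow> real \<Rightarrow> nat \<Rightarrow> complex \<Rightarrow> (nat \<Rightarrow> nat) \<Rightarrow> (nat \<Rightarrow> nat) \<Rightarrow> fn \<Rightarrow> fn \<Rightarrow> fn" where
  "star n x r \<delta> a b f g = (\<lambda>w \<kappa>.
     (1 / of_nat (\<Prod>j\<in>{1..n-1}. fact (a j + b j))) *
     (\<Sum>\<sigma>\<in>perm_fams n (\<lambda>j. a j + b j).
        star_term n x r \<delta> a b f g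
          (\<lambda>j c. w j (\<sigma> j c)) (\<lambda>j d. w j (\<sigma> j (a j + d))) \<kappa>))"

definition segtype :: "nat \<Rightarrow> nat \<Rightarrow> nat \<Rightarrow> nat" where
  "segtype i m j = (if i \<le> j \<and> j \<le> i + m then 1 else 0)"

definition fseg :: "real \<Rightarrow> nat \<Rightarrow> complex \<Rightarrow> nat \<Rightarrow> nat \<Rightarrow> (nat \<Rightarrow> complex) \<Rightarrow> fn" where
  "fseg x r \<delta> i m k = (\<lambda>w \<kappa>.
     (let kk = (\<lambda>j. if j = 0 then -1 else if j = m + 1 then 0 else k j) in
      (\<Prod>j\<in>{1..m}. brk x r (w (i + j - 1) 1 - w (i + j) 1 - (kk j + 1/2) * \<delta>)
                    / brk x r (w (i + j - 1) 1 - w (i + j) 1))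
    * (\<Prod>j\<in>{0..m}. brk x r (w (i + j) 1 - (kk j - kk (j + 1) + 1/2) * \<delta> - \<kappa> (i + j)))))"

end

theory Submission
  imports Defs "HOL-Complex_Analysis.Complex_Analysis"
begin

text \<open>By the Jacobi triple product the bracket is, up to a constant, a sum of Gaussians; multiplying two
  such sums and separating parities gives \<open>[a + b] [a - b] = H a T b - T a H b\<close>, hence oddness and
  Weierstrass' four-term identity.

  Symmetrising over the permutations amounts to choosing, at each node of the segment, which of its two
  variables goes into the first factor. So the star product is the partition function of a chain with
  two states per site, made of boundary weights, site weights and link weights between neighbours. A
  \<open>2 \<times> 2\<close> matrix with parameter \<open>l = p \<delta>\<close> can be carried through the chain from left to right; on its
  way it interchanges the two families of spectral parameters, and at both ends it is absorbed at the
  cost of the same factor \<open>[\<delta> - l]\<close>. Where this factor vanishes the theorem follows by continuity in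
  \<open>p\<close>, because a nonzero entire function has isolated zeros.\<close>

section \<open>Functions with a Weierstrass addition formula\<close>

text \<open>The right-hand side is the 2x2 minor of the columns \<open>(H x, T x)\<close> and
  \<open>(H y, T y)\<close>. This determinantal form is the only property of the bracket on which
  the exchange relations rest.\<close>

locale weierstrass_fun =
  fixes f H T :: "complex \<Rightarrow> complex"
  assumes plucker: "f (x + y) * f (x - y) = H x * T y - T x * H y"
begin

text \<open>Swapping the two columns changes the sign of the minor; with half-sum and
  half-difference as arguments this fixes \<open>f s\<close> and replaces \<open>f z\<close> by
  \<open>f (- z)\<close>. A point with \<open>f s \<noteq> 0\<close> allows cancellation.\<close>

lemma odd: "f (- z) = - f z"
proof (cases "\<forall>s. f s = 0")
  case False
  then obtain s where s: "f s \<noteq> 0" by blast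
  define a b where "a = (s + z) / 2" and "b = (s - z) / 2"
  have ab: "a + b = s" "a - b = z" "b + a = s" "b - a = - z"
    by (auto simp: a_def b_def field_simps)
  have "f s * f (- z) = - (f s * f z)"
    using plucker[of a b] plucker[of b a] unfolding ab by algebra
  then have "f s * (f (- z) + f z) = 0" by (simp add: algebra_simps)
  then show ?thesis using s by (simp add: add_eq_0_iff2)
qed auto

lemma odd_diff: "f (y - x) = - f (x - y)"
  using odd[of "x - y"] by simp

text \<open>This is the Pluecker relation among the six minors of the 2x4 matrix with columns
  \<open>(H, T)\<close> at \<open>a\<close>, \<open>b\<close>, \<open>c\<close>,
  \<open>d\<close>.\<close>

lemma weierstrass:
  "f (a + b) * f (a - b) * (f (c + d) * f (c - d))
    - f (a + c) * f (a - c) * (f (b + d) * f (b - d))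
    + f (a + d) * f (a - d) * (f (b + c) * f (b - c)) = 0"
  unfolding plucker by (simp add: algebra_simps)

lemma link_aux:
  fixes x x' y y' c l :: complex
  shows "f (y - y') * f (x - x' + l) * f (x - y - c - l) * f (x' - y' - c)
      - f (x - x') * f (y - y' + l) * f (x - y - c) * f (x' - y' - c - l)
      = - (f l * f (x - x' - (y - y')) * f (x' - y - c - l) * f (x - y' - c))"
proof -
  \<comment> \<open>These half-sums solve the linear system that prescribes the arguments of the
    twelve factors in \<open>weierstrass\<close>.\<close>
  define a b d e where "a = (x - y' - c + (x' - y - c) - l) / 2"
    and "b = (x - x' + (y - y') + l) / 2"
    and "d = (x - x' - (y - y') + l) / 2" and "e = (x - x' - (y - y') - l) / 2"
  have *: "a + b = x - y' - c" "a - b = x' - y - c - l" "d + e = x - x' - (y - y')" "d - e = l"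
    "a + d = x - y - c" "a - d = x' - y' - c - l" "b + e = x - x'" "b - e = y - y' + l"
    "a + e = x - y - c - l" "a - e = x' - y' - c" "b + d = x - x' + l" "b - d = y - y'"
    unfolding a_def b_def d_def e_def by (auto simp: field_simps)
  then show ?thesis
    using weierstrass[of a b d e] unfolding * by algebra
qed

text \<open>Again one instance of \<open>weierstrass\<close>; it governs how the 2x2 matrix is
  absorbed at an end of the chain.\<close>

lemma boundary_left:
  "f (a + \<delta>) * f (a' + l) * f \<delta> * f (a - a' + l) - f (a' + \<delta>) * f (a + l) * f l * f (a - a' + \<delta>)
     = f (\<delta> - l) * f (a + l + \<delta>) * f a' * f (a - a')"
proof -
  define A B C D where "A = (a + a' + l + \<delta>) / 2" and "B = (a - a' + l + \<delta>) / 2"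
    and "C = (a - a' + \<delta> - l) / 2" and "D = (a - a' - \<delta> + l) / 2"
  have *: "A + B = a + l + \<delta>" "A - B = a'" "C + D = a - a'" "C - D = \<delta> - l"
    "A + C = a + \<delta>" "A - C = a' + l" "B + D = a - a' + l" "B - D = \<delta>"
    "A + D = a + l" "A - D = a' + \<delta>" "B + C = a - a' + \<delta>" "B - C = l"
    unfolding A_def B_def C_def D_def by (auto simp: field_simps)
  then show ?thesis
    using weierstrass[of A B C D] unfolding * by algebra
qed

lemma boundary_right:
  "f \<delta> * f (b - b' + l) * f (b - l + \<delta>) * f b' - f l * f (b - b' + \<delta>) * f (b' - l + \<delta>) * f b
     = f (\<delta> - l) * f (b + \<delta>) * f (b' - l) * f (b - b')"
  using boundary_left[of "b - l" \<delta> "b' - l" l] by (simp add: algebra_simps)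

end

section \<open>The exchange relation for a chain of two-state sites\<close>

text \<open>\<open>X j True\<close> and \<open>X j False\<close> are the two variables at node \<open>j\<close>; the state \<open>b j\<close> of the site says which
  of them enters the first factor of the star product, the other one entering the second.\<close>

locale chain = weierstrass_fun +
  fixes X :: "nat \<Rightarrow> bool \<Rightarrow> complex" and \<delta> :: complex
  assumes nz: "f (X j True - X j False) \<noteq> 0"
begin

definition gap :: "nat \<Rightarrow> bool \<Rightarrow> complex" where
  "gap j b = X j b - X j (\<not> b)"

lemma gap_nz: "f (gap j b) \<noteq> 0"
  using nz[of j] odd_diff[of "X j True" "X j False"] by (cases b) (auto simp: gap_def)

lemma gap_not: "gap j (\<not> b) = - gap j b"
  by (simp add: gap_def)

text \<open>The travelling 2x2 matrix, with spectral parameter \<open>l\<close>; both entries of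
  column \<open>c\<close> involve only \<open>gap j c\<close>. At \<open>l = 0\<close> it is
  \<open>f \<delta>\<close> times the identity, and at \<open>l = \<delta>\<close> its rank drops to
  at most one, where the factor \<open>f (\<delta> - l)\<close> vanishes.\<close>

definition rmat :: "complex \<Rightarrow> nat \<Rightarrow> bool \<Rightarrow> bool \<Rightarrow> complex" where
  "rmat l j b c = (if b = c then f \<delta> * f (gap j c + l) else - (f l * f (gap j c + \<delta>))) / f (gap j c)"

definition site :: "nat \<Rightarrow> bool \<Rightarrow> complex" where
  "site j b = f (gap j b - \<delta>) / f (gap j b)"

text \<open>The numerators that couple nodes \<open>j\<close> and \<open>j + 1\<close>: two from the
  segment functions, with parameter \<open>c\<close> in the first and \<open>d\<close> in the
  second, and two from the star product. The denominators are split off because they do not depend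
  on the states.\<close>

definition link :: "nat \<Rightarrow> complex \<Rightarrow> complex \<Rightarrow> bool \<Rightarrow> bool \<Rightarrow> complex" where
  "link j c d b e = f (X j b - X (Suc j) e - c) * f (X j (\<not> b) - X (Suc j) (\<not> e) - d)
      * f (X j b - X (Suc j) (\<not> e) + \<delta> / 2) * f (X (Suc j) e - X j (\<not> b) + \<delta> / 2)"

lemma sum_bool: "(\<Sum>c\<in>UNIV. g c) = g b + g (\<not> b)" for g :: "bool \<Rightarrow> complex"
  by (cases b) (auto simp: UNIV_bool add.commute)

text \<open>By oddness, conjugating with the diagonal matrix of site weights transposes
  \<open>rmat\<close>. Passing a site therefore exchanges the two indices.\<close>

lemma rmat_site: "rmat l j b c * site j c = site j b * rmat l j c b"
proof (cases "b = c")
  case False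
  then have c: "c = (\<not> b)" by auto
  have [simp]: "f (\<delta> - gap j b) = - f (gap j b - \<delta>)" "f (- gap j b - \<delta>) = - f (gap j b + \<delta>)"
    using odd_diff[of "\<delta>" "gap j b"] odd[of "gap j b + \<delta>"] by simp_all
  show ?thesis
    using gap_nz[of j b] by (simp add: c rmat_def site_def gap_not odd)
qed simp

text \<open>Grouping the four terms by the products of links they share leaves two instances of
  \<open>link_aux\<close>, one with parameter \<open>l\<close> and one with \<open>\<delta>\<close>, whose right-hand sides cancel.\<close>

lemma rmat_link:
  "(\<Sum>b'\<in>UNIV. rmat l j b' b * link j (c + l) c b' e)
    = (\<Sum>e'\<in>UNIV. link j c (c + l) b e' * rmat l (Suc j) e' e)"
proof -
  define x x' y y' where "x = X j b" and "x' = X j (\<not> b)" and "y = X (Suc j) e" and "y' = X (Suc j) (\<not> e)"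
  have g: "gap j b = x - x'" "gap (Suc j) e = y - y'" by (auto simp: gap_def x_def x'_def y_def y'_def)
  have nz1: "f (x - x') \<noteq> 0" "f (y - y') \<noteq> 0" using gap_nz[of j b] gap_nz[of "Suc j" e] g by auto
  define h where "h = \<delta> / 2"
  have dh: "\<delta> = h + h" by (simp add: h_def)
  have gb: "rmat l j (\<not> b) b = - (f l * f (x - x' + \<delta>)) / f (x - x')" 
    
    "rmat l j b b = f \<delta> * f (x - x' + l) / f (x - x')"
    "rmat l (Suc j) (\<not> e) e = - (f l * f (y - y' + \<delta>)) / f (y - y')" 
    "rmat l (Suc j) e e = f \<delta> * f (y - y' + l) / f (y - y')"
    by (auto simp: rmat_def g)
  define P where "P = f (x - x') * f (y - y')"
  define A B where "A = f (x - x' - (y - y'))" and "B = f (x - y' + h) * f (y - x' + h)"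
  have 1: "f (y - y') * f (x - x' + l) * (f (x - y - c - l) * f (x' - y' - c))
      - f (x - x') * f (y - y' + l) * (f (x - y - c) * f (x' - y' - c - l))
      = - (f l * A * f (x' - y - c - l) * f (x - y' - c))"
    using link_aux[of y y' x x' l c] by (simp add: A_def mult_ac)
  \<comment> \<open>With \<open>l = \<delta>\<close> and \<open>c = - \<delta> / 2\<close> the
    shifts \<open>- c\<close> and \<open>- c - l\<close> become plus and minus
    \<open>\<delta> / 2\<close>; oddness turns the latter into the factors of
    \<open>link\<close>.\<close>
  have 2: "f (y - y') * f (x - x' + \<delta>) * (f (x' - y' + h) * f (y - x + h))
      - f (x - x') * f (y - y' + \<delta>) * (f (x - y + h) * f (y' - x' + h))
      = - (f \<delta> * A * B)"
    using link_aux[of y y' x x' \<delta> "- h"] odd[of "x - y - h"] odd[of "x' - y' - h"] odd[of "x' - y - h"]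
    by (simp add: A_def B_def dh algebra_simps)
  have lk: "link j (c + l) c b e = f (x - y - c - l) * f (x' - y' - c) * B"
    "link j c (c + l) b e = f (x - y - c) * f (x' - y' - c - l) * B"
    "link j (c + l) c (\<not> b) e = f (x' - y - c - l) * f (x - y' - c) * (f (x' - y' + h) * f (y - x + h))"
    "link j c (c + l) b (\<not> e) = f (x - y' - c) * f (x' - y - c - l) * (f (x - y + h) * f (y' - x' + h))"
    by (simp_all add: link_def B_def x_def x'_def y_def y'_def h_def diff_diff_add add.assoc)
  have L: "f (x - x') * (\<Sum>b'\<in>UNIV. rmat l j b' b * link j (c + l) c b' e)
      = f \<delta> * f (x - x' + l) * link j (c + l) c b e
        - f l * f (x - x' + \<delta>) * link j (c + l) c (\<not> b) e"
    using nz1 by (simp add: sum_bool[of _ b] gb distrib_left right_diff_distrib)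
  have R: "f (y - y') * (\<Sum>e'\<in>UNIV. link j c (c + l) b e' * rmat l (Suc j) e' e)
      = f \<delta> * f (y - y' + l) * link j c (c + l) b e
        - f l * f (y - y' + \<delta>) * link j c (c + l) b (\<not> e)"
    using nz1 by (simp add: sum_bool[of _ e] gb distrib_left right_diff_distrib mult_ac)
  have "f (x - x') * f (y - y') * (\<Sum>b'\<in>UNIV. rmat l j b' b * link j (c + l) c b' e)
      = f (x - x') * f (y - y') * (\<Sum>e'\<in>UNIV. link j c (c + l) b e' * rmat l (Suc j) e' e)"
    using L R 1 2 unfolding lk by algebra
  then show ?thesis using nz1 by simp
qed

text \<open>This is \<open>boundary_left\<close> divided by \<open>f (gap j c)\<close>: the shift
  \<open>l\<close> passes from the variable of the second factor to that of the first.\<close>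

lemma rmat_left:
  "(\<Sum>b\<in>UNIV. f (X j b - a + \<delta>) * f (X j (\<not> b) - a + l) * rmat l j b c)
     = f (\<delta> - l) * (f (X j c - a + l + \<delta>) * f (X j (\<not> c) - a))"
proof -
  have g: "X j c - a - (X j (\<not> c) - a) = gap j c" by (simp add: gap_def)
  have "rmat l j c c * f (gap j c) = f \<delta> * f (gap j c + l)"
       "rmat l j (\<not> c) c * f (gap j c) = - (f l * f (gap j c + \<delta>))"
    using gap_nz[of j c] by (simp_all add: rmat_def)
  then have "(\<Sum>b\<in>UNIV. f (X j b - a + \<delta>) * f (X j (\<not> b) - a + l) * rmat l j b c) * f (gap j c)
     = f (\<delta> - l) * (f (X j c - a + l + \<delta>) * f (X j (\<not> c) - a)) * f (gap j c)"
    using boundary_left[of "X j c - a" \<delta> "X j (\<not> c) - a" l] gap_nz[of j c]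
    unfolding g sum_bool[of _ c] not_not by algebra
  then show ?thesis using gap_nz[of j c] by simp
qed

text \<open>The counterpart for the last site, from \<open>boundary_right\<close>: the shift
  \<open>- l\<close> passes from the variable of the first factor to that of the second, with the
  same scalar \<open>f (\<delta> - l)\<close>.\<close>

lemma rmat_right:
  "(\<Sum>c\<in>UNIV. rmat l j c b * (f (X j c - a - l + \<delta>) * f (X j (\<not> c) - a)))
     = f (\<delta> - l) * (f (X j b - a + \<delta>) * f (X j (\<not> b) - a - l))"
proof -
  have g: "X j b - a - (X j (\<not> b) - a) = gap j b" by (simp add: gap_def)
  have "rmat l j b b * f (gap j b) = f \<delta> * f (gap j b + l)"
       "rmat l j (\<not> b) b * f (gap j b) = - (f l * f (gap j b + \<delta>))"
    using gap_nz[of j b] by (simp_all add: rmat_def)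
  then have "(\<Sum>c\<in>UNIV. rmat l j c b * (f (X j c - a - l + \<delta>) * f (X j (\<not> c) - a))) * f (gap j b)
     = f (\<delta> - l) * (f (X j b - a + \<delta>) * f (X j (\<not> b) - a - l)) * f (gap j b)"
    using boundary_right[of \<delta> "X j b - a" "X j (\<not> b) - a" l] gap_nz[of j b]
    unfolding g sum_bool[of _ b] not_not by algebra
  then show ?thesis using gap_nz[of j b] by simp
qed

text \<open>Transfer vector: the partition function of sites \<open>0\<close> to \<open>j\<close>
  with the state of site \<open>j\<close> held fixed. \<open>L\<close> is the left boundary weight
  and \<open>s\<close> collects link factors that do not depend on the states.\<close>

fun tvec :: "(bool \<Rightarrow> complex) \<Rightarrow> (nat \<Rightarrow> complex) \<Rightarrow> (nat \<Rightarrow> complex) \<Rightarrow> (nat \<Rightarrow> complex) \<Rightarrow> nat \<Rightarrow> bool \<Rightarrow> complex" where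
  "tvec L s c d 0 b = L b * site 0 b"
| "tvec L s c d (Suc j) b = (\<Sum>a\<in>UNIV. tvec L s c d j a * (s j * link j (c j) (d j) a b)) * site (Suc j) b"

end

lemma sum_PiE_insert:
  fixes g :: "('i \<Rightarrow> 'a :: finite) \<Rightarrow> 'b :: comm_monoid_add"
  assumes "i \<notin> S"
  shows "(\<Sum>b\<in>(insert i S \<rightarrow>\<^sub>E UNIV). g b) = (\<Sum>b\<in>(S \<rightarrow>\<^sub>E UNIV). \<Sum>c\<in>UNIV. g (b(i := c)))"
proof -
  have "inj_on (\<lambda>(y, g). g(i := y)) ((UNIV :: 'a set) \<times> (S \<rightarrow>\<^sub>E UNIV))"
    using assms by (rule inj_combinator)
  then have "(\<Sum>b\<in>(insert i S \<rightarrow>\<^sub>E UNIV). g b)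
      = (\<Sum>p\<in>UNIV \<times> (S \<rightarrow>\<^sub>E UNIV). g ((snd p)(i := fst p)))"
    by (simp add: PiE_insert_eq sum.reindex case_prod_beta' o_def)
  also have "\<dots> = (\<Sum>c\<in>UNIV. \<Sum>b\<in>(S \<rightarrow>\<^sub>E UNIV). g (b(i := c)))"
    unfolding sum.cartesian_product by (simp add: case_prod_beta')
  also have "\<dots> = (\<Sum>b\<in>(S \<rightarrow>\<^sub>E UNIV). \<Sum>c\<in>UNIV. g (b(i := c)))"
    by (rule sum.swap)
  finally show ?thesis .
qed

context chain
begin

text \<open>Transfer-matrix summation. The weight \<open>g\<close> must be arbitrary in the
  induction, because summing out the last site turns it into a new weight on the site
  before.\<close>

lemma sum_configurations:
  "(\<Sum>b\<in>({..m} \<rightarrow>\<^sub>E UNIV). L (b 0) * (\<Prod>j\<le>m. site j (b j))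
       * (\<Prod>j<m. s j * link j (c j) (d j) (b j) (b (Suc j))) * g (b m))
    = (\<Sum>a\<in>UNIV. tvec L s c d m a * g a)"
proof (induction m arbitrary: g)
  case 0
  have "{..0::nat} = insert 0 {}" by auto
  then show ?case by (simp only:) (subst sum_PiE_insert, auto)
next
  case (Suc m)
  have "(\<Sum>b\<in>({..Suc m} \<rightarrow>\<^sub>E UNIV). L (b 0) * (\<Prod>j\<le>Suc m. site j (b j))
       * (\<Prod>j<Suc m. s j * link j (c j) (d j) (b j) (b (Suc j))) * g (b (Suc m)))
    = (\<Sum>b\<in>({..m} \<rightarrow>\<^sub>E UNIV). L (b 0) * (\<Prod>j\<le>m. site j (b j))
       * (\<Prod>j<m. s j * link j (c j) (d j) (b j) (b (Suc j)))
       * (\<Sum>a\<in>UNIV. s m * link m (c m) (d m) (b m) a * site (Suc m) a * g a))"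
    unfolding atMost_Suc sum_distrib_left
    by (subst sum_PiE_insert) (auto intro!: sum.cong prod.cong simp: mult_ac)
  also have "\<dots> = (\<Sum>a\<in>UNIV. tvec L s c d m a
       * (\<Sum>e\<in>UNIV. s m * link m (c m) (d m) a e * site (Suc m) e * g e))"
    by (rule Suc.IH)
  also have "\<dots> = (\<Sum>a\<in>UNIV. tvec L s c d (Suc m) a * g a)"
    by (simp add: UNIV_bool algebra_simps)
  finally show ?case .
qed

text \<open>The matrix moves one node per induction step: \<open>rmat_site\<close> takes it past the
  site, \<open>rmat_link\<close> past the link, whose two parameters are thereby interchanged. It
  stands transposed here because the site weight of node \<open>j\<close> is already included in
  \<open>tvec\<close>.\<close>

lemma tvec_rmat:
  assumes L: "\<And>e. (\<Sum>b\<in>UNIV. L b * rmat l 0 b e) = K * L' e"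
  shows "(\<Sum>b\<in>UNIV. tvec L s c (\<lambda>j. c j + l) j b * rmat l j e b)
    = K * tvec L' s (\<lambda>j. c j + l) c j e"
proof (induction j arbitrary: e)
  case 0
  have "(\<Sum>b\<in>UNIV. tvec L s c (\<lambda>j. c j + l) 0 b * rmat l 0 e b)
      = (\<Sum>b\<in>UNIV. L b * (rmat l 0 b e * site 0 e))"
    unfolding rmat_site by (simp add: mult_ac)
  also have "\<dots> = (\<Sum>b\<in>UNIV. L b * rmat l 0 b e) * site 0 e"
    by (simp add: sum_distrib_left mult_ac)
  finally show ?case by (simp add: L)
next
  case (Suc j)
  let ?v = "tvec L s c (\<lambda>j. c j + l)" and ?v' = "tvec L' s (\<lambda>j. c j + l) c"
  have "(\<Sum>b\<in>UNIV. ?v (Suc j) b * rmat l (Suc j) e b)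
      = (\<Sum>b\<in>UNIV. (\<Sum>a\<in>UNIV. ?v j a * (s j * link j (c j) (c j + l) a b)) * (rmat l (Suc j) b e * site (Suc j) e))"
    unfolding rmat_site by (simp add: mult_ac)
  also have "\<dots> = s j * (\<Sum>a\<in>UNIV. ?v j a * (\<Sum>b\<in>UNIV. link j (c j) (c j + l) a b * rmat l (Suc j) b e)) * site (Suc j) e"
    by (simp add: UNIV_bool algebra_simps)
  also have "\<dots> = s j * (\<Sum>a\<in>UNIV. ?v j a * (\<Sum>b\<in>UNIV. rmat l j b a * link j (c j + l) (c j) b e)) * site (Suc j) e"
    unfolding rmat_link ..
  also have "\<dots> = s j * (\<Sum>b\<in>UNIV. (\<Sum>a\<in>UNIV. ?v j a * rmat l j b a) * link j (c j + l) (c j) b e) * site (Suc j) e"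
    by (simp add: UNIV_bool algebra_simps)
  also have "\<dots> = K * ?v' (Suc j) e"
    unfolding Suc.IH by (simp add: UNIV_bool algebra_simps)
  finally show ?case .
qed

lemma chain_exchange:
  fixes A B l :: complex and m :: nat and s c :: "nat \<Rightarrow> complex"
  assumes K: "f (\<delta> - l) \<noteq> 0"
  defines "L \<equiv> (\<lambda>l b. f (X 0 b - A + l + \<delta>) * f (X 0 (\<not> b) - A))"
    and "L' \<equiv> (\<lambda>l b. f (X 0 b - A + \<delta>) * f (X 0 (\<not> b) - A + l))"
    and "R \<equiv> (\<lambda>l b. f (X m b - B - l + \<delta>) * f (X m (\<not> b) - B))"
    and "R' \<equiv> (\<lambda>l b. f (X m b - B + \<delta>) * f (X m (\<not> b) - B - l))"
  shows "(\<Sum>b\<in>({..m} \<rightarrow>\<^sub>E UNIV). L' l (b 0) * (\<Prod>j\<le>m. site j (b j))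
       * (\<Prod>j<m. s j * link j (c j) (c j + l) (b j) (b (Suc j))) * R' l (b m))
    = (\<Sum>b\<in>({..m} \<rightarrow>\<^sub>E UNIV). L l (b 0) * (\<Prod>j\<le>m. site j (b j))
       * (\<Prod>j<m. s j * link j (c j + l) (c j) (b j) (b (Suc j))) * R l (b m))"
proof -
  let ?K = "f (\<delta> - l)"
  have L: "(\<Sum>b\<in>UNIV. L' l b * rmat l 0 b e) = ?K * L l e" for e
    unfolding L_def L'_def by (rule rmat_left)
  have R: "(\<Sum>b\<in>UNIV. rmat l m b e * R l b) = ?K * R' l e" for e
    unfolding R_def R'_def by (rule rmat_right)
  let ?v = "tvec (L' l) s c (\<lambda>j. c j + l) m" and ?v' = "tvec (L l) s (\<lambda>j. c j + l) c m"
  \<comment> \<open>The factor \<open>?K\<close> creates the matrix at the right end; contracted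
    with the transfer vector it yields the exchanged vector and the same \<open>?K\<close> from the
    left end, so \<open>?K\<close> cancels.\<close>
  have "?K * (\<Sum>a\<in>UNIV. ?v a * R' l a) = (\<Sum>a\<in>UNIV. ?v a * (\<Sum>b\<in>UNIV. rmat l m b a * R l b))"
    unfolding R by (simp add: sum_distrib_left mult_ac)
  also have "\<dots> = (\<Sum>b\<in>UNIV. (\<Sum>a\<in>UNIV. ?v a * rmat l m b a) * R l b)"
    by (simp add: UNIV_bool algebra_simps)
  also have "\<dots> = ?K * (\<Sum>a\<in>UNIV. ?v' a * R l a)"
    unfolding tvec_rmat[OF L] by (simp add: sum_distrib_left mult_ac)
  finally have "(\<Sum>a\<in>UNIV. ?v a * R' l a) = (\<Sum>a\<in>UNIV. ?v' a * R l a)"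
    using K by simp
  then show ?thesis
    unfolding sum_configurations[where L = "L' l" and g = "R' l"]
      sum_configurations[where L = "L l" and g = "R l"] .
qed

end

section \<open>Sums of Gaussian type over the integers\<close>

lemma has_sum_product:
  fixes f :: "'a \<Rightarrow> complex" and g :: "'b \<Rightarrow> complex"
  assumes f: "(f has_sum F) A" "(\<lambda>x. norm (f x)) summable_on A" and g: "(g has_sum G) B" "(\<lambda>y. norm (g y)) summable_on B"
  shows "((\<lambda>(x, y). f x * g y) has_sum F * G) (A \<times> B)"
proof (rule has_sum_SigmaI)
  show "((\<lambda>y. case (x, y) of (x, y) \<Rightarrow> f x * g y) has_sum f x * G) B" for x
    using has_sum_cmult_right[OF g(1)] by simp
  show "((\<lambda>x. f x * G) has_sum F * G) A"
    by (rule has_sum_cmult_left[OF f(1)])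
  have "(\<lambda>(x, y). norm (f x) * norm (g y)) summable_on A \<times> B"
  proof (rule summable_on_SigmaI)
    show "((\<lambda>y. case (x, y) of (x, y) \<Rightarrow> norm (f x) * norm (g y))
        has_sum norm (f x) * infsum (\<lambda>y. norm (g y)) B) B" for x
      using has_sum_cmult_right[OF has_sum_infsum[OF g(2)]] by simp
    show "(\<lambda>x. norm (f x) * infsum (\<lambda>y. norm (g y)) B) summable_on A"
      by (rule summable_on_cmult_left[OF f(2)])
  qed auto
  then have "(\<lambda>p. norm (case p of (x, y) \<Rightarrow> f x * g y)) summable_on A \<times> B"
    by (simp add: norm_mult case_prod_beta')
  then show "(\<lambda>(x, y). f x * g y) summable_on A \<times> B"
    by (rule abs_summable_summable)
qed

lemma summable_exp_neg_nat: "(\<lambda>n::nat. exp (- real n)) summable_on UNIV"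
proof (rule norm_summable_imp_summable_on)
  have "summable (\<lambda>n. exp (- 1 :: real) ^ n)" by (rule summable_geometric) simp
  then show "summable (\<lambda>n. norm (exp (- real n)))"
    by (simp add: exp_of_nat_mult[symmetric])
qed

lemma summable_exp_neg_abs_int: "(\<lambda>n::int. exp (- \<bar>real_of_int n\<bar>)) summable_on UNIV"
proof -
  have 1: "(\<lambda>n::int. exp (- \<bar>real_of_int n\<bar>)) summable_on range int"
    using summable_exp_neg_nat by (subst summable_on_reindex) (auto simp: o_def inj_on_def)
  have 2: "(\<lambda>n::int. exp (- \<bar>real_of_int n\<bar>)) summable_on range (\<lambda>n. - int n)"
    using summable_exp_neg_nat by (subst summable_on_reindex) (auto simp: o_def inj_on_def)
  have "n \<in> range int \<union> range (\<lambda>n. - int n)" for n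
    using int_cases2[of n] by (metis UnI1 UnI2 rangeI)
  then have U: "UNIV = range int \<union> range (\<lambda>n. - int n)" by blast
  show ?thesis by (subst U) (rule summable_on_union[OF 1 2])
qed

lemma summable_gauss_int:
  fixes \<alpha> \<beta> \<gamma> :: real
  assumes "\<alpha> > 0"
  shows "(\<lambda>n::int. exp (- \<alpha> * (of_int n)\<^sup>2 + \<beta> * of_int n + \<gamma>)) summable_on UNIV"
proof -
  \<comment> \<open>\<open>K\<close> is the maximum over \<open>\<bar>t\<bar>\<close> of \<open>-
    \<alpha> * t^2 + (\<bar>\<beta>\<bar> + 1) * \<bar>t\<bar> + \<gamma>\<close>; the added 1
    leaves room for the majorant \<open>exp (- \<bar>n\<bar>)\<close>.\<close>
  define K where "K = (\<bar>\<beta>\<bar> + 1)\<^sup>2 / (4 * \<alpha>) + \<gamma>"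
  have le: "- \<alpha> * t\<^sup>2 + \<beta> * t + \<gamma> \<le> K - \<bar>t\<bar>" for t :: real
  proof -
    have "\<beta> * t \<le> \<bar>\<beta>\<bar> * \<bar>t\<bar>" by (metis abs_ge_self abs_mult)
    moreover have "0 \<le> (2 * \<alpha> * \<bar>t\<bar> - (\<bar>\<beta>\<bar> + 1))\<^sup>2 / (4 * \<alpha>)" using assms by simp
    moreover have "(2 * \<alpha> * \<bar>t\<bar> - (\<bar>\<beta>\<bar> + 1))\<^sup>2 / (4 * \<alpha>)
        = \<alpha> * t\<^sup>2 - (\<bar>\<beta>\<bar> + 1) * \<bar>t\<bar> + (\<bar>\<beta>\<bar> + 1)\<^sup>2 / (4 * \<alpha>)"
      using assms by (simp add: power2_eq_square field_simps)
    ultimately show ?thesis unfolding K_def by (simp add: algebra_simps)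
  qed
  show ?thesis
  proof (rule summable_on_comparison_test)
    show "(\<lambda>n::int. exp K * exp (- \<bar>real_of_int n\<bar>)) summable_on UNIV"
      by (rule summable_on_cmult_right[OF summable_exp_neg_abs_int])
    show "exp (- \<alpha> * (of_int n)\<^sup>2 + \<beta> * of_int n + \<gamma>) \<le> exp K * exp (- \<bar>real_of_int n\<bar>)" for n :: int
      using le[of "of_int n"] by (simp add: exp_add[symmetric])
  qed auto
qed

text \<open>Tannery's theorem for series over the naturals, transported to the integers along the
  bijection \<open>int_decode\<close>.\<close>

lemma int_dominated_convergence:
  fixes A :: "nat \<Rightarrow> int \<Rightarrow> complex"
  assumes lim: "\<And>n. (\<lambda>N. A N n) \<longlonglongrightarrow> b n"
    and bound: "\<And>N n. norm (A N n) \<le> M n" and M: "M summable_on UNIV"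
    and s: "\<And>N. (A N has_sum s N) UNIV" and S: "s \<longlonglongrightarrow> S"
  shows "(b has_sum S) UNIV"
proof -
  have re: "bij_betw int_decode UNIV UNIV" by (rule bij_int_decode)
  have sM: "summable (\<lambda>k. M (int_decode k))"
    using M by (intro summable_on_imp_summable) (simp add: summable_on_reindex_bij_betw[OF re])
  have bnd: "\<forall>\<^sub>F (k, N) in sequentially \<times>\<^sub>F sequentially. norm (A N (int_decode k)) \<le> M (int_decode k)"
    using bound by (intro always_eventually) auto
  note T = tannerys_theorem[of "\<lambda>k N. A N (int_decode k)" "\<lambda>k. b (int_decode k)" sequentially,
      OF lim bnd sM sequentially_bot]
  have "summable (\<lambda>k. norm (b (int_decode k)))" and
    l: "(\<lambda>N. \<Sum>k. A N (int_decode k)) \<longlonglongrightarrow> (\<Sum>k. b (int_decode k))"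
    using T by auto
  then have sb: "(\<lambda>k. b (int_decode k)) summable_on UNIV"
    by (intro norm_summable_imp_summable_on)
  have "(\<Sum>k. A N (int_decode k)) = s N" for N
    using s[of N] by (intro sums_unique[symmetric] has_sum_imp_sums) (simp add: has_sum_reindex_bij_betw[OF re])
  with l S have e: "(\<Sum>k. b (int_decode k)) = S"
    by (simp add: LIMSEQ_unique)
  have "((\<lambda>k. b (int_decode k)) has_sum infsum (\<lambda>k. b (int_decode k)) UNIV) UNIV"
    using sb by (rule has_sum_infsum)
  moreover from has_sum_imp_sums[OF this] have "infsum (\<lambda>k. b (int_decode k)) UNIV = S"
    using e sums_unique by metis
  ultimately show ?thesis by (simp add: has_sum_reindex_bij_betw[OF re])
qed

section \<open>The Jacobi triple product\<close>

fun qbinom :: "complex \<Rightarrow> nat \<Rightarrow> nat \<Rightarrow> complex" where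
  "qbinom q n 0 = 1"
| "qbinom q 0 (Suc k) = 0"
| "qbinom q (Suc n) (Suc k) = qbinom q n (Suc k) + q ^ (n - k) * qbinom q n k"

lemma qbinom_eq_0: "k > n \<Longrightarrow> qbinom q n k = 0"
  by (induction q n k rule: qbinom.induct) auto

definition qfact :: "complex \<Rightarrow> nat \<Rightarrow> complex" where
  "qfact q n = (\<Prod>k<n. 1 - q ^ Suc k)"

lemma qfact_Suc: "qfact q (Suc n) = qfact q n * (1 - q ^ Suc n)"
  by (simp add: qfact_def)

text \<open>The factorial formula is kept multiplied out, so that it also holds at roots of unity,
  where \<open>qfact\<close> can vanish. The induction combines the formulas for the two terms of
  the Pascal recursion.\<close>

lemma qbinom_qfact: "k \<le> n \<Longrightarrow> qbinom q n k * qfact q k * qfact q (n - k) = qfact q n"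
proof (induction q n k rule: qbinom.induct)
  case (1 q n)
  then show ?case by (simp add: qfact_def)
next
  case (3 q n k)
  show ?case
  proof (cases "k = n")
    case True
    then have "qbinom q n n * qfact q n = qfact q n"
      using 3 by (simp add: qfact_def)
    then show ?thesis
      using True by (cases "qfact q n = 0") (auto simp: qbinom_eq_0 qfact_Suc qfact_def[of q 0])
  next
    case False
    then obtain d where d: "n = Suc (k + d)"
      using "3.prems" by (metis Suc_le_mono le_neq_implies_less less_imp_Suc_add)
    have a: "qbinom q n (Suc k) * qfact q (Suc k) * qfact q d = qfact q n"
      using 3 d by simp
    have b: "qbinom q n k * qfact q k * qfact q (Suc d) = qfact q n"
      using 3 d by (simp add: Suc_diff_le)
    have e: "n - k = Suc d" "Suc n - Suc k = Suc d" using d by auto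
    have p: "q ^ Suc n = q ^ Suc d * q ^ Suc k"
      by (simp add: d power_add mult_ac)
    have "qbinom q (Suc n) (Suc k) * qfact q (Suc k) * qfact q (Suc d)
        = (qbinom q n (Suc k) * qfact q (Suc k) * qfact q d) * (1 - q ^ Suc d)
          + q ^ Suc d * (qbinom q n k * qfact q k * qfact q (Suc d)) * (1 - q ^ Suc k)"
      by (simp only: qbinom.simps e qfact_Suc) (simp add: algebra_simps)
    also have "\<dots> = qfact q (Suc n)"
      unfolding a b by (simp only: qfact_Suc p) (simp add: algebra_simps)
    finally show ?thesis by (simp only: e)
  qed
qed simp

text \<open>An integer-valued exponent, so that \<open>q powi tri n\<close> makes sense for negative
  \<open>n\<close> as well; the division is exact.\<close>

definition tri :: "int \<Rightarrow> int" where
  "tri n = n * (n - 1) div 2"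

lemma two_tri: "2 * tri n = n * (n - 1)"
  by (simp add: tri_def)

lemma tri_add: "tri (m + n) = tri m + tri n + m * n"
proof -
  have "2 * tri (m + n) = 2 * (tri m + tri n + m * n)"
    unfolding distrib_left two_tri by (simp add: algebra_simps)
  then show ?thesis by simp
qed

lemma tri_0 [simp]: "tri 0 = 0" and tri_1 [simp]: "tri 1 = 0"
  by (simp_all add: tri_def)

lemma tri_Suc: "tri (1 + int n) = tri (int n) + int n"
  by (simp add: tri_add)

text \<open>The Pascal recursion splits the sum in two. As
  \<open>t (Suc k) = - y * q ^ k * t k\<close>, the second part is \<open>- y * q ^ n\<close> times
  the sum for \<open>n\<close>, which accounts for the new factor
  \<open>1 - y * q ^ n\<close>.\<close>

lemma q_binomial_theorem:
  assumes "q \<noteq> 0"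
  shows "(\<Prod>k<n. 1 - y * q ^ k) = (\<Sum>k\<le>n. (- y) ^ k * q powi tri (int k) * qbinom q n k)"
proof (induction n)
  case (Suc n)
  define t where "t = (\<lambda>k. (- y) ^ k * q powi tri (int k))"
  have tS: "t (Suc k) = - y * q ^ k * t k" for k
    using assms by (simp add: t_def tri_Suc power_int_add)
  have "(\<Sum>k\<le>Suc n. t k * qbinom q (Suc n) k)
      = 1 + (\<Sum>k\<le>n. t (Suc k) * qbinom q (Suc n) (Suc k))"
    by (subst sum.atMost_Suc_shift) (simp add: t_def)
  also have "\<dots> = (1 + (\<Sum>k\<le>n. t (Suc k) * qbinom q n (Suc k)))
        + (\<Sum>k\<le>n. t (Suc k) * q ^ (n - k) * qbinom q n k)"
    by (simp add: algebra_simps sum.distrib)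
  also have "1 + (\<Sum>k\<le>n. t (Suc k) * qbinom q n (Suc k)) = (\<Sum>k\<le>Suc n. t k * qbinom q n k)"
    by (subst sum.atMost_Suc_shift) (simp add: t_def)
  also have "\<dots> = (\<Sum>k\<le>n. t k * qbinom q n k)"
    by (simp add: qbinom_eq_0)
  also have "(\<Sum>k\<le>n. t (Suc k) * q ^ (n - k) * qbinom q n k) = - y * q ^ n * (\<Sum>k\<le>n. t k * qbinom q n k)"
    unfolding sum_distrib_left
  proof (intro sum.cong refl)
    fix k assume "k \<in> {..n}"
    then have "q ^ n = q ^ k * q ^ (n - k)" by (simp add: power_add[symmetric])
    then show "t (Suc k) * q ^ (n - k) * qbinom q n k = - y * q ^ n * (t k * qbinom q n k)"
      unfolding tS by simp
  qed
  finally show ?case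
    using Suc by (simp add: t_def algebra_simps)
qed simp

lemma jacobi_triple_product_finite:
  assumes "q \<noteq> 0" "z \<noteq> 0"
  shows "(\<Prod>k<N. 1 - z * q ^ k) * (\<Prod>k<N. 1 - q ^ Suc k / z)
    = (\<Sum>n\<in>{- int N..int N}. (- z) powi n * q powi tri n * qbinom q (2 * N) (nat (int N + n)))"
proof -
  \<comment> \<open>The \<open>q\<close>-binomial theorem is applied to \<open>2 * N\<close> factors
    at this \<open>y\<close>: the last \<open>N\<close> give the product in \<open>z\<close>, the
    first \<open>N\<close> the product in \<open>1 / z\<close> up to \<open>C\<close>. The sum is
    then recentred at \<open>k = N\<close>.\<close>
  define y where "y = z * q powi (- int N)"
  \<comment> \<open>\<open>C\<close> is the product of \<open>- z * q powi (- (k + 1))\<close> over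
    \<open>k < N\<close>; the exponent of \<open>q\<close> equals
    \<open>- N * (N + 1) / 2\<close>.\<close>
  define C where "C = (- z) powi int N * q powi (tri (int N) - int N * int N)"
  have C0: "C \<noteq> 0" using assms by (simp add: C_def)
  have "(\<Prod>k<N. 1 - y * q ^ k) = (\<Prod>k<N. 1 - y * q ^ (N - Suc k))"
    by (rule prod.nat_diff_reindex[symmetric])
  also have "\<dots> = (\<Prod>k<N. (- z * q powi (- int (Suc k))) * (1 - q ^ Suc k / z))"
  proof (intro prod.cong refl)
    fix k assume "k \<in> {..<N}"
    then have "q ^ N = q ^ Suc k * q ^ (N - Suc k)"
      by (simp add: power_add[symmetric] del: power_Suc)
    then have "y * q ^ (N - Suc k) = z * q powi (- int (Suc k))"
      using assms by (simp add: y_def power_int_minus field_simps del: of_nat_Suc power_Suc)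
    moreover have "q powi (- int (Suc k)) * q ^ Suc k = 1"
      using assms by (simp add: power_int_minus del: power_Suc of_nat_Suc)
    ultimately show "1 - y * q ^ (N - Suc k) = (- z * q powi (- int (Suc k))) * (1 - q ^ Suc k / z)"
      using assms(2) by (simp add: field_simps del: power_Suc of_nat_Suc)
  qed
  also have "\<dots> = C * (\<Prod>k<N. 1 - q ^ Suc k / z)"
  proof -
    have "(\<Prod>k<N. - z * q powi (- int (Suc k))) = C"
      unfolding C_def
    proof (induction N)
      case (Suc N)
      have "tri (int (Suc N)) - int (Suc N) * int (Suc N) = (tri (int N) - int N * int N) + - int (Suc N)"
        by (simp add: tri_Suc algebra_simps)
      then have "q powi (tri (int (Suc N)) - int (Suc N) * int (Suc N))
          = q powi (tri (int N) - int N * int N) * q powi (- int (Suc N))"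
        using assms by (metis power_int_add)
      moreover have "(- z) powi int (Suc N) = (- z) powi int N * (- z)"
        by (simp only: power_int_of_nat power_Suc2)
      ultimately show ?case
        using Suc assms by (simp only: prod.lessThan_Suc) (simp del: of_nat_Suc)
    qed simp
    then show ?thesis by (simp only: prod.distrib)
  qed
  finally have 1: "(\<Prod>k<N. 1 - y * q ^ k) = C * (\<Prod>k<N. 1 - q ^ Suc k / z)" .
  have 2: "(\<Prod>k<N. 1 - z * q ^ k) = (\<Prod>k<N. 1 - y * q ^ (N + k))"
    using assms by (intro prod.cong refl) (simp add: y_def power_int_minus power_add)
  have "(\<Prod>k<N + M. 1 - y * q ^ k) = (\<Prod>k<N. 1 - y * q ^ k) * (\<Prod>k<M. 1 - y * q ^ (N + k))" for M
    by (induction M) (simp_all add: mult_ac)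
  from this[of N] have "C * ((\<Prod>k<N. 1 - z * q ^ k) * (\<Prod>k<N. 1 - q ^ Suc k / z)) = (\<Prod>k<2 * N. 1 - y * q ^ k)"
    unfolding 1 2 mult_2 by (simp only: mult_ac)
  also have "\<dots> = (\<Sum>k\<le>2 * N. (- y) ^ k * q powi tri (int k) * qbinom q (2 * N) k)"
    by (rule q_binomial_theorem) fact
  also have "\<dots> = (\<Sum>n\<in>{- int N..int N}. C * ((- z) powi n * q powi tri n * qbinom q (2 * N) (nat (int N + n))))"
  proof (rule sum.reindex_bij_witness[of _ "\<lambda>n. nat (int N + n)" "\<lambda>k. int k - int N"])
    fix k assume "k \<in> {..2 * N}"
    define n where "n = int k - int N"
    have k: "int k = int N + n" by (simp add: n_def)
    have "(- y) ^ k = (- z) powi int k * q powi (- int N * int k)"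
    proof -
      have "- y = (- z) * q powi (- int N)" by (simp add: y_def)
      then show ?thesis
        by (simp only: power_mult_distrib power_int_mult power_int_of_nat)
    qed
    then have "(- y) ^ k * q powi tri (int k) = (- z) powi (int N + n) * q powi (tri (int N + n) + - int N * (int N + n))"
      using power_int_add[of q "tri (int N + n)" "- int N * (int N + n)"] assms
      by (simp only: k mult_ac) simp
    also have "tri (int N + n) + - int N * (int N + n) = (tri (int N) - int N * int N) + tri n"
      by (simp add: tri_add algebra_simps)
    finally have "(- y) ^ k * q powi tri (int k) = C * ((- z) powi n * q powi tri n)"
      using assms by (simp add: C_def power_int_add)
    then show "C * ((- z) powi n * q powi tri n * qbinom q (2 * N) (nat (int N + n)))
        = (- y) ^ k * q powi tri (int k) * qbinom q (2 * N) k"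
      by (simp add: k[symmetric])
  qed auto
  also have "\<dots> = C * (\<Sum>n\<in>{- int N..int N}. (- z) powi n * q powi tri n * qbinom q (2 * N) (nat (int N + n)))"
    by (simp add: sum_distrib_left)
  finally show ?thesis using C0 by simp
qed

section \<open>Infinite q-products and passage to the limit\<close>

lemma convergent_prod_qpoch:
  fixes q :: complex
  assumes "norm q < 1"
  shows "convergent_prod (\<lambda>k. 1 - z * q ^ k)"
proof (rule abs_convergent_prod_imp_convergent_prod)
  have "summable (\<lambda>k. norm z * norm q ^ k)"
    using assms by (intro summable_mult summable_geometric) simp
  then show "abs_convergent_prod (\<lambda>k. 1 - z * q ^ k)"
    by (simp add: abs_convergent_prod_conv_summable norm_mult norm_power)
qed

lemma qpoch_LIMSEQ:
  assumes "norm q < 1"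
  shows "(\<lambda>N. \<Prod>k<N. 1 - z * q ^ k) \<longlonglongrightarrow> qpoch z q"
  using convergent_prod_LIMSEQ[OF convergent_prod_qpoch[OF assms, of z]]
  unfolding qpoch_def by (simp add: LIMSEQ_lessThan_iff_atMost)

lemma qpoch_eq_0_iff:
  assumes "norm q < 1"
  shows "qpoch z q = 0 \<longleftrightarrow> (\<exists>k. z * q ^ k = 1)"
proof -
  have "qpoch z q = 0 \<longleftrightarrow> 0 \<in> range (\<lambda>k. 1 - z * q ^ k)"
    unfolding qpoch_def by (rule has_prod_eq_0_iff[OF convergent_prod_has_prod[OF convergent_prod_qpoch[OF assms]]])
  also have "\<dots> \<longleftrightarrow> (\<exists>k. z * q ^ k = 1)"
    by (auto simp: image_iff)
  finally show ?thesis .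
qed

lemma power_Suc_neq_1:
  fixes q :: complex
  assumes "norm q < 1"
  shows "q ^ Suc k \<noteq> 1"
proof
  assume "q ^ Suc k = 1"
  then have "norm q ^ Suc k = 1" by (metis norm_one norm_power)
  moreover have "norm q ^ k \<le> 1" using assms by (intro power_le_one) auto
  then have "norm q ^ Suc k < 1" using assms mult_left_le[of "norm q ^ k" "norm q"] by simp
  ultimately show False by simp
qed

lemma qfact_LIMSEQ: "norm q < 1 \<Longrightarrow> qfact q \<longlonglongrightarrow> qpoch q q"
  using qpoch_LIMSEQ[of q q] by (simp add: qfact_def[abs_def])

lemma qfact_nonzero: "norm q < 1 \<Longrightarrow> qfact q n \<noteq> 0"
  using power_Suc_neq_1[of q] by (auto simp: qfact_def)

lemma qpoch_self_nonzero: "norm q < 1 \<Longrightarrow> qpoch q q \<noteq> 0"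
  using power_Suc_neq_1[of q] by (simp add: qpoch_eq_0_iff)

text \<open>Both \<open>qfact q\<close> and its inverse are bounded, since \<open>qfact q\<close>
  converges to a nonzero limit. This uniform bound supplies the majorant for dominated
  convergence.\<close>

lemma qbinom_bounded:
  assumes "norm q < 1"
  obtains C where "\<And>n k. norm (qbinom q n k) \<le> C"
proof -
  have "Bseq (qfact q)"
    using convergentI[OF qfact_LIMSEQ[OF assms]] by (rule convergent_imp_Bseq)
  then obtain A where A: "\<And>n. norm (qfact q n) \<le> A" by (auto simp: Bseq_def)
  have "Bseq (\<lambda>n. inverse (qfact q n))"
    using convergentI[OF tendsto_inverse[OF qfact_LIMSEQ[OF assms] qpoch_self_nonzero[OF assms]]]
    by (rule convergent_imp_Bseq)
  then obtain B where B: "\<And>n. norm (inverse (qfact q n)) \<le> B" by (auto simp: Bseq_def)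
  have A0: "0 \<le> A" and B0: "0 \<le> B" using A[of 0] B[of 0] norm_ge_zero order_trans by blast+
  have "norm (qbinom q n k) \<le> A * (B * B)" for n k
  proof (cases "k \<le> n")
    case True
    have "qbinom q n k = qfact q n * (inverse (qfact q k) * inverse (qfact q (n - k)))"
      using qbinom_qfact[OF True, of q] qfact_nonzero[OF assms] by (simp add: field_simps)
    then show ?thesis
      using A B A0 B0 by (simp only: norm_mult) (intro mult_mono, auto)
  next
    case False
    then show ?thesis using A0 B0 by (simp add: qbinom_eq_0)
  qed
  then show ?thesis by (rule that)
qed

text \<open>This is the shape that \<open>summable_gauss_int\<close> handles: for
  \<open>norm q < 1\<close> the quadratic coefficient is negative.\<close>

lemma norm_theta_term:
  fixes q z :: complex
  assumes "q \<noteq> 0" "z \<noteq> 0"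
  shows "norm ((- z) powi n * q powi tri n)
    = exp (ln (norm q) / 2 * (of_int n)\<^sup>2 + (ln (norm z) - ln (norm q) / 2) * of_int n)"
proof -
  have p: "a powi m = exp (of_int m * ln a)" if "a > 0" for a :: real and m
    using that by (simp add: exp_power_int[symmetric] mult.commute)
  have "2 * real_of_int (tri n) = of_int (n * (n - 1))"
    unfolding two_tri[symmetric] by simp
  then have t: "real_of_int (tri n) = of_int n * (of_int n - 1) / 2" by simp
  have "norm ((- z) powi n * q powi tri n) = exp (of_int n * ln (norm z) + of_int (tri n) * ln (norm q))"
    using assms by (simp add: norm_mult norm_power_int p exp_add)
  then show ?thesis unfolding t by (simp add: power2_eq_square field_simps)
qed

theorem jacobi_triple_product:
  assumes "q \<noteq> 0" "norm q < 1" "z \<noteq> 0"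
  shows "((\<lambda>n. (- z) powi n * q powi tri n) has_sum Theta q z) UNIV"
proof -
  define t where "t = (\<lambda>n. (- z) powi n * q powi tri n)"
  obtain C where C: "\<And>n k. norm (qbinom q n k) \<le> C" using qbinom_bounded[OF assms(2)] by blast
  have C0: "C \<ge> 0" using C[of 0 0] norm_ge_zero order_trans by blast
  define A where "A = (\<lambda>N n. if n \<in> {- int N..int N} then t n * qbinom q (2 * N) (nat (int N + n)) else 0)"
  \<comment> \<open>The central coefficients \<open>qbinom q (2 * N) (N + n)\<close> tend to
    \<open>1 / qpoch q q\<close>; multiplying this constant back in supplies the third factor of
    \<open>Theta\<close>.\<close>
  have "((\<lambda>n. t n * inverse (qpoch q q)) has_sum qpoch z q * qpoch (q / z) q) UNIV"
  proof (rule int_dominated_convergence)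
    show "norm (A N n) \<le> norm (t n) * C" for N n
      using C C0 by (auto simp: A_def norm_mult intro!: mult_left_mono)
    have "(\<lambda>n. norm (t n)) summable_on UNIV"
      unfolding t_def norm_theta_term[OF assms(1,3)]
      using summable_gauss_int[of "- ln (norm q) / 2" _ 0] assms by simp
    then show "(\<lambda>n. norm (t n) * C) summable_on UNIV"
      by (rule summable_on_cmult_left)
    show "(A N has_sum ((\<Prod>k<N. 1 - z * q ^ k) * (\<Prod>k<N. 1 - q / z * q ^ k))) UNIV" for N
    proof (rule has_sum_finite_neutralI[where B = "{- int N..int N}"])
      show "(\<Prod>k<N. 1 - z * q ^ k) * (\<Prod>k<N. 1 - q / z * q ^ k) = sum (A N) {- int N..int N}"
        using jacobi_triple_product_finite[OF assms(1,3), of N] by (simp add: A_def t_def)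
    qed (auto simp: A_def)
    show "(\<lambda>N. (\<Prod>k<N. 1 - z * q ^ k) * (\<Prod>k<N. 1 - q / z * q ^ k)) \<longlonglongrightarrow> qpoch z q * qpoch (q / z) q"
      using assms(2) by (intro tendsto_mult qpoch_LIMSEQ)
    show "(\<lambda>N. A N n) \<longlonglongrightarrow> t n * inverse (qpoch q q)" for n
    proof -
      let ?Q = "qpoch q q"
      have Q: "(\<lambda>N. qfact q (g N)) \<longlonglongrightarrow> ?Q" if "filterlim g at_top sequentially" for g
        using filterlim_compose[OF qfact_LIMSEQ[OF assms(2)] that] .
      have f: "filterlim (\<lambda>N. nat (int N + m)) at_top sequentially" for m
        unfolding filterlim_at_top eventually_sequentially
      proof
        fix Z show "\<exists>K. \<forall>N\<ge>K. Z \<le> nat (int N + m)"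
          by (intro exI[of _ "nat (int Z + \<bar>m\<bar>)"]) auto
      qed
      have "filterlim (\<lambda>N. 2 * N) at_top sequentially"
        by (rule filterlim_subseq) (simp add: strict_mono_def)
      then have "(\<lambda>N. t n * (qfact q (2 * N) / (qfact q (nat (int N + n)) * qfact q (nat (int N + - n)))))
          \<longlonglongrightarrow> t n * (?Q / (?Q * ?Q))"
        using qpoch_self_nonzero[OF assms(2)] by (intro tendsto_intros Q f) auto
      moreover have "\<forall>\<^sub>F N in sequentially. t n * (qfact q (2 * N) / (qfact q (nat (int N + n)) * qfact q (nat (int N + - n)))) = A N n"
        unfolding eventually_sequentially
      proof (intro exI allI impI)
        fix N assume "nat \<bar>n\<bar> \<le> N"
        then have N: "n \<in> {- int N..int N}" "nat (int N + n) \<le> 2 * N" "2 * N - nat (int N + n) = nat (int N + - n)" by auto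
        show "t n * (qfact q (2 * N) / (qfact q (nat (int N + n)) * qfact q (nat (int N + - n)))) = A N n"
          using qbinom_qfact[OF N(2), of q] N qfact_nonzero[OF assms(2)]
          by (simp add: A_def field_simps)
      qed
      ultimately have "(\<lambda>N. A N n) \<longlonglongrightarrow> t n * (?Q / (?Q * ?Q))"
        by (rule Lim_transform_eventually)
      then show ?thesis using qpoch_self_nonzero[OF assms(2)] by (simp add: field_simps)
    qed
  qed
  from has_sum_cmult_left[OF this, of "qpoch q q"] show ?thesis
    using qpoch_self_nonzero[OF assms(2)] by (simp add: t_def Theta_def mult.assoc)
qed

section \<open>The bracket as a theta series\<close>

context
  fixes x :: real and r :: nat
  assumes x: "0 < x" "x < 1" and r: "r > 0"
begin

lemma cpow_real_add: "cpow_real x (a + b) = cpow_real x a * cpow_real x b"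
  by (simp add: cpow_real_def exp_add[symmetric] distrib_right)

lemma cpow_real_nonzero: "cpow_real x a \<noteq> 0"
  by (simp add: cpow_real_def)

lemma cpow_real_powi: "cpow_real x a powi n = cpow_real x (of_int n * a)"
  by (simp add: cpow_real_def exp_power_int mult_ac)

lemma norm_cpow_real: "norm (cpow_real x a) = exp (Re a * ln x)"
  by (simp add: cpow_real_def)

lemma nome: "complex_of_real (x ^ (2 * r)) = cpow_real x (2 * of_nat r)"
proof -
  have "cpow_real x (2 * of_nat r) = exp (of_nat (2 * r) * of_real (ln x))"
    by (simp add: cpow_real_def)
  also have "\<dots> = exp (of_real (ln x)) ^ (2 * r)"
    by (rule exp_of_nat_mult)
  finally show ?thesis using x by (simp add: exp_of_real)
qed

lemma nome_bounds: "complex_of_real (x ^ (2 * r)) \<noteq> 0" "norm (complex_of_real (x ^ (2 * r))) < 1"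
proof -
  have "x ^ (2 * r) < 1" using x r by (intro power_less_one_iff[THEN iffD2]) auto
  then show "norm (complex_of_real (x ^ (2 * r))) < 1" using x by (simp add: norm_power)
qed (use x in simp)

text \<open>The factor \<open>x^(r/4)\<close> completes the square:
  \<open>u^2 / r - u + r / 4 = (u - r / 2)^2 / r\<close>.\<close>

definition sbrk :: "complex \<Rightarrow> complex" where
  "sbrk u = cpow_real x (of_nat r / 4) * brk x r u"

definition gauss_term :: "complex \<Rightarrow> int \<Rightarrow> complex" where
  "gauss_term a s = cpow_real x (2 / of_nat r * (a + of_nat r * of_int s / 2)\<^sup>2)"

text \<open>In the triple product with nome \<open>x^(2r)\<close> at \<open>x^(2u)\<close>, the
  exponents \<open>r / 4\<close>, \<open>u^2 / r - u\<close>, \<open>2 * u * n\<close> and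
  \<open>r * n * (n - 1)\<close> add up to a single square divided by \<open>r\<close>.\<close>

lemma sbrk_has_sum:
  "((\<lambda>n. (- 1) powi n * cpow_real x ((u + of_nat r * (of_int n - 1/2))\<^sup>2 / of_nat r)) has_sum sbrk u) UNIV"
proof -
  define q where "q = complex_of_real (x ^ (2 * r))"
  have q: "q = cpow_real x (2 * of_nat r)" by (simp only: q_def nome)
  have "((\<lambda>n. cpow_real x (of_nat r / 4) * (cpow_real x (u\<^sup>2 / of_nat r - u)
      * ((- cpow_real x (2 * u)) powi n * q powi tri n))) has_sum
      cpow_real x (of_nat r / 4) * (cpow_real x (u\<^sup>2 / of_nat r - u) * Theta q (cpow_real x (2 * u)))) UNIV"
    using nome_bounds cpow_real_nonzero
    by (intro has_sum_cmult_right jacobi_triple_product) (auto simp: q_def)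
  moreover have "cpow_real x (of_nat r / 4) * (cpow_real x (u\<^sup>2 / of_nat r - u)
      * ((- cpow_real x (2 * u)) powi n * q powi tri n))
    = (- 1) powi n * cpow_real x ((u + of_nat r * (of_int n - 1/2))\<^sup>2 / of_nat r)" for n
  proof -
    have m: "(- cpow_real x (2 * u)) powi n = (- 1) powi n * cpow_real x (of_int n * (2 * u))"
      using power_int_mult_distrib[of "- 1" "cpow_real x (2 * u)" n] by (simp add: cpow_real_powi)
    have "2 * complex_of_int (tri n) = of_int (n * (n - 1))"
      unfolding two_tri[symmetric] by simp
    then have t: "complex_of_int (tri n) = of_int n * (of_int n - 1) / 2" by (simp add: field_simps)
    have e: "(u + of_nat r * (of_int n - 1/2))\<^sup>2 / of_nat r
        = of_nat r / 4 + (u\<^sup>2 / of_nat r - u + (of_int n * (2 * u) + of_int (tri n) * (2 * of_nat r)))"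
      using r unfolding t by (simp add: power2_eq_square field_simps)
    show ?thesis unfolding m q cpow_real_powi e cpow_real_add by (simp only: mult_ac)
  qed
  ultimately show ?thesis unfolding sbrk_def brk_def q_def[symmetric] by (simp only:)
qed

lemma cpow_real_square_abs_summable:
  fixes b c :: real
  assumes "b \<noteq> 0" "c > 0"
  shows "(\<lambda>s::int. norm (cpow_real x ((a + of_real b * of_int s)\<^sup>2 * of_real c))) summable_on A"
proof -
  have "norm (cpow_real x ((a + of_real b * of_int s)\<^sup>2 * of_real c))
    = exp (- (- ln x * c * b\<^sup>2) * (of_int s)\<^sup>2 + 2 * ln x * c * Re a * b * of_int s
           + ln x * c * ((Re a)\<^sup>2 - (Im a)\<^sup>2))" for s :: int
    unfolding norm_cpow_real by (simp add: power2_eq_square algebra_simps)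
  moreover have "- ln x * c * b\<^sup>2 > 0"
    using x assms by (simp add: mult_neg_pos)
  ultimately have "(\<lambda>s::int. norm (cpow_real x ((a + of_real b * of_int s)\<^sup>2 * of_real c))) summable_on UNIV"
    by (simp only:) (rule summable_gauss_int)
  then show ?thesis by (rule summable_on_subset_banach) simp
qed

lemma gauss_term_abs_summable: "(\<lambda>s. norm (gauss_term a s)) summable_on A"
proof -
  have "gauss_term a s = cpow_real x ((a + of_real (real r / 2) * of_int s)\<^sup>2 * of_real (2 / real r))" for s
    by (simp add: gauss_term_def mult_ac)
  then show ?thesis
    using cpow_real_square_abs_summable[of "real r / 2" "2 / real r" a A] r by simp
qed

lemma sbrk_abs_summable:
  "(\<lambda>n. norm ((- 1) powi n * cpow_real x ((u + of_nat r * (of_int n - 1/2))\<^sup>2 / of_nat r))) summable_on UNIV"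
proof -
  have "norm ((- 1) powi n * cpow_real x ((u + of_nat r * (of_int n - 1/2))\<^sup>2 / of_nat r))
      = norm (cpow_real x ((u - of_nat r / 2 + of_real (real r) * of_int n)\<^sup>2 * of_real (1 / real r)))" for n :: int
  proof -
    have *: "u + of_nat r * (of_int n - 1/2) = u - of_nat r / 2 + of_real (real r) * of_int n"
      by (simp add: algebra_simps)
    show ?thesis unfolding * norm_mult norm_power_int by simp
  qed
  then show ?thesis
    by (simp only:) (rule cpow_real_square_abs_summable, use r in auto)
qed

definition gauss_sum :: "int set \<Rightarrow> complex \<Rightarrow> complex" where
  "gauss_sum A a = infsum (gauss_term a) A"

lemma gauss_term_has_sum: "(gauss_term a has_sum gauss_sum A a) A"
  unfolding gauss_sum_def
  by (rule has_sum_infsum[OF abs_summable_summable[OF gauss_term_abs_summable]])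

lemma gauss_term_product_has_sum:
  "((\<lambda>(s, d). gauss_term a s * gauss_term b d) has_sum gauss_sum A a * gauss_sum B b) (A \<times> B)"
  by (intro has_sum_product gauss_term_has_sum gauss_term_abs_summable)

text \<open>The parallelogram law \<open>(P + Q)^2 + (P - Q)^2 = 2 * P^2 + 2 * Q^2\<close> separates
  \<open>a\<close> from \<open>b\<close> in the double series once it is indexed by
  \<open>s = n + m - 1\<close> and \<open>d = n - m\<close>. These have opposite parity, and the
  sign is positive exactly when \<open>s\<close> is odd, which gives the two products.\<close>

lemma sbrk_product:
  "sbrk (a + b) * sbrk (a - b)
    = gauss_sum {s. odd s} a * gauss_sum {s. even s} b - gauss_sum {s. even s} a * gauss_sum {s. odd s} b"
proof -
  define T where "T = (\<lambda>u n. (- 1) powi n * cpow_real x ((u + of_nat r * (of_int n - 1/2))\<^sup>2 / of_nat r))"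
  define h where "h = (\<lambda>(s, d). (if odd s then 1 else - 1) * (gauss_term a s * gauss_term b d))"
  let ?O = "{s :: int. odd s}" and ?E = "{s :: int. even s}"
  have "((\<lambda>(n, m). T (a + b) n * T (a - b) m) has_sum sbrk (a + b) * sbrk (a - b)) (UNIV \<times> UNIV)"
    unfolding T_def by (intro has_sum_product sbrk_has_sum sbrk_abs_summable)
  also have "?this \<longleftrightarrow> (h has_sum sbrk (a + b) * sbrk (a - b)) (?O \<times> ?E \<union> ?E \<times> ?O)"
  proof (rule has_sum_reindex_bij_witness[where j = "\<lambda>(n, m). (n + m - 1, n - m)"
        and i = "\<lambda>(s, d). ((s + d + 1) div 2, (s - d + 1) div 2)"], goal_cases)
    case (5 p)
    obtain n m where p: "p = (n, m)" by (cases p)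
    define P Q where "P = a + of_nat r * of_int (n + m - 1) / 2" and "Q = b + of_nat r * of_int (n - m) / 2"
    have PQ: "a + b + of_nat r * (of_int n - 1/2) = P + Q" "a - b + of_nat r * (of_int m - 1/2) = P - Q"
      by (simp_all add: P_def Q_def field_simps)
    have "(a + b + of_nat r * (of_int n - 1/2))\<^sup>2 / of_nat r + (a - b + of_nat r * (of_int m - 1/2))\<^sup>2 / of_nat r
       = 2 / of_nat r * P\<^sup>2 + 2 / of_nat r * Q\<^sup>2"
      unfolding PQ by (simp add: power2_eq_square add_divide_distrib[symmetric]) (simp add: algebra_simps)
    then have "cpow_real x ((a + b + of_nat r * (of_int n - 1/2))\<^sup>2 / of_nat r)
        * cpow_real x ((a - b + of_nat r * (of_int m - 1/2))\<^sup>2 / of_nat r)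
        = gauss_term a (n + m - 1) * gauss_term b (n - m)"
      unfolding gauss_term_def cpow_real_add[symmetric] P_def Q_def by (simp only:)
    moreover have "(- 1 :: complex) powi n * (- 1) powi m = (if odd (n + m - 1) then 1 else - 1)"
      by (simp add: power_int_minus_left)
    moreover have "T (a + b) n * T (a - b) m = ((- 1) powi n * (- 1) powi m)
        * (cpow_real x ((a + b + of_nat r * (of_int n - 1/2))\<^sup>2 / of_nat r)
        * cpow_real x ((a - b + of_nat r * (of_int m - 1/2))\<^sup>2 / of_nat r))"
      unfolding T_def by (simp only: mult_ac)
    ultimately show ?case
      unfolding p h_def by (simp only: prod.case)
  next
    case (1 p)
    then show ?case by (cases p) simp
  next
    case (2 p)
    obtain n m where "p = (n, m)" by (cases p)
    moreover have "odd (n + m - 1) \<longleftrightarrow> even (n - m)" by presburger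
    ultimately show ?case by auto
  next
    case (3 p)
    obtain s d where p: "p = (s, d)" by (cases p)
    then have "odd (s + d)" using 3 by auto
    then have "2 * ((s + d + 1) div 2) = s + d + 1" "2 * ((s - d + 1) div 2) = s - d + 1" by presburger+
    then show ?case unfolding p by simp
  qed simp_all
  finally have 1: "(h has_sum sbrk (a + b) * sbrk (a - b)) (?O \<times> ?E \<union> ?E \<times> ?O)" .
  have "(h has_sum gauss_sum ?O a * gauss_sum ?E b) (?O \<times> ?E)"
    using gauss_term_product_has_sum[of a b ?O ?E]
    by (rule has_sum_cong[THEN iffD1, rotated]) (auto simp: h_def)
  moreover have "(h has_sum - (gauss_sum ?E a * gauss_sum ?O b)) (?E \<times> ?O)"
    using has_sum_uminusI[OF gauss_term_product_has_sum[of a b ?E ?O]]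
    by (rule has_sum_cong[THEN iffD1, rotated]) (auto simp: h_def)
  ultimately have "(h has_sum gauss_sum ?O a * gauss_sum ?E b + - (gauss_sum ?E a * gauss_sum ?O b))
      (?O \<times> ?E \<union> ?E \<times> ?O)"
    by (rule has_sum_Un_disjoint) auto
  from has_sum_unique[OF 1 this] show ?thesis by simp
qed

lemma brk_addition:
  "\<exists>H T. \<forall>a b. brk x r (a + b) * brk x r (a - b) = H a * T b - T a * H b"
proof -
  let ?c = "cpow_real x (of_nat r / 4)"
  have "brk x r (a + b) * brk x r (a - b)
     = gauss_sum {s. odd s} a / ?c * (gauss_sum {s. even s} b / ?c)
       - gauss_sum {s. even s} a / ?c * (gauss_sum {s. odd s} b / ?c)" for a b
    using sbrk_product[of a b] cpow_real_nonzero[of "of_nat r / 4"]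
    by (simp add: sbrk_def field_simps)
  then show ?thesis by (intro exI allI)
qed

section \<open>Holomorphy and a nonvanishing value of the bracket\<close>

lemma holomorphic_qpoch:
  assumes "norm q < 1"
  shows "(\<lambda>z. qpoch z q) holomorphic_on UNIV"
proof (rule holomorphic_uniform_sequence)
  show "(\<lambda>z. \<Prod>k<N. 1 - z * q ^ k) holomorphic_on UNIV" for N
    by (intro holomorphic_intros)
  show "\<exists>d>0. cball z d \<subseteq> UNIV \<and>
      uniform_limit (cball z d) (\<lambda>N z. \<Prod>k<N. 1 - z * q ^ k) (\<lambda>z. qpoch z q) sequentially" for z
  proof (intro exI[of _ 1] conjI)
    have "uniformly_convergent_on (cball z 1) (\<lambda>N z. \<Prod>k<N. 1 - z * q ^ k)"
    proof (rule uniformly_convergent_on_prod')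
      show "uniformly_convergent_on (cball z 1) (\<lambda>N z. \<Sum>k<N. norm (1 - z * q ^ k - 1))"
      proof (rule Weierstrass_m_test')
        show "summable (\<lambda>k. (norm z + 1) * norm q ^ k)"
          using assms by (intro summable_mult summable_geometric) simp
        fix k w assume "w \<in> cball z 1"
        then have "norm w \<le> norm z + 1"
          using norm_triangle_ineq2[of w z] by (simp add: dist_norm norm_minus_commute)
        then show "norm (norm (1 - w * q ^ k - 1)) \<le> (norm z + 1) * norm q ^ k"
          by (simp add: norm_mult norm_power mult_right_mono)
      qed
    qed (auto intro!: continuous_intros)
    then obtain g where g: "uniform_limit (cball z 1) (\<lambda>N z. \<Prod>k<N. 1 - z * q ^ k) g sequentially"
      by (auto simp: uniformly_convergent_on_def)
    moreover have "g w = qpoch w q" if "w \<in> cball z 1" for w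
      using tendsto_uniform_limitI[OF g that] qpoch_LIMSEQ[OF assms, of w] by (rule LIMSEQ_unique)
    ultimately show "uniform_limit (cball z 1) (\<lambda>N z. \<Prod>k<N. 1 - z * q ^ k) (\<lambda>z. qpoch z q) sequentially"
      by (subst uniform_limit_cong'[symmetric]) auto
  qed auto
qed auto

lemma holomorphic_brk: "brk x r holomorphic_on UNIV"
proof -
  have c: "(\<lambda>u. cpow_real x (g u)) holomorphic_on UNIV" if "g holomorphic_on UNIV" for g
    unfolding cpow_real_def using that by (intro holomorphic_intros)
  have q: "(\<lambda>u. qpoch (g u) (complex_of_real (x ^ (2 * r)))) holomorphic_on UNIV" if "g holomorphic_on UNIV" for g
    using holomorphic_on_compose_gen[OF that holomorphic_qpoch[OF nome_bounds(2)]] by (simp add: o_def)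
  show ?thesis
    unfolding brk_def[abs_def] Theta_def
    using r by (intro holomorphic_intros c q) (auto simp: cpow_real_nonzero)
qed

text \<open>At \<open>u = 1 / 2\<close> the theta argument is \<open>x\<close>, and both
  \<open>x\<close> and \<open>x^(2r) / x\<close> have modulus below 1, so no factor of the infinite
  products vanishes.\<close>

lemma brk_nonzero: "brk x r (1 / 2) \<noteq> 0"
proof -
  let ?q = "complex_of_real (x ^ (2 * r))"
  have nz: "qpoch z ?q \<noteq> 0" if "norm z < 1" for z
  proof
    assume "qpoch z ?q = 0"
    then obtain k where "z * ?q ^ k = 1" using qpoch_eq_0_iff[OF nome_bounds(2)] by blast
    then have "norm z * norm ?q ^ k = 1" by (metis norm_mult norm_one norm_power)
    moreover have "norm ?q ^ k \<le> 1" using nome_bounds(2) by (intro power_le_one) auto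
    then have "norm z * norm ?q ^ k \<le> norm z" by (simp add: mult_left_le)
    ultimately show False using that by simp
  qed
  have z: "cpow_real x 1 = of_real x" using x by (simp add: cpow_real_def exp_of_real)
  have "x ^ (2 * r) \<le> x ^ 2" using x r by (intro power_decreasing) auto
  also have "\<dots> < x" using x by (simp add: power2_eq_square)
  finally have "norm (?q / of_real x) < 1" using x by (simp add: norm_divide norm_power)
  moreover have "norm (complex_of_real x) < 1" using x by simp
  ultimately show ?thesis
    using nz nz[OF nome_bounds(2)] cpow_real_nonzero by (simp add: brk_def Theta_def z)
qed

end

section \<open>The star product of two segment functions\<close>

lemma prod_segment:
  fixes g :: "nat \<Rightarrow> 'a :: comm_monoid_mult"
  assumes "finite A" "{i..<i + m} \<subseteq> A"
  shows "(\<Prod>j\<in>A. if i \<le> j \<and> j < i + m then g j else 1) = (\<Prod>j<m. g (i + j))"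
proof -
  have "(\<Prod>j\<in>A. if i \<le> j \<and> j < i + m then g j else 1) = (\<Prod>j\<in>{i..<i + m}. g j)"
    using assms by (intro prod.mono_neutral_cong_right) auto
  also have "\<dots> = (\<Prod>j<m. g (i + j))"
    by (rule prod.reindex_bij_witness[of _ "\<lambda>j. i + j" "\<lambda>j. j - i"]) auto
  finally show ?thesis .
qed

lemma prod_segtype:
  "(\<Prod>c\<in>{1..segtype i m j}. g c) = (if i \<le> j \<and> j \<le> i + m then g 1 else 1)"
  by (simp add: segtype_def)

text \<open>State \<open>True\<close> is the identity, so variable 1 enters the first factor;
  \<open>False\<close> swaps the two variables of the node.\<close>

definition flip_fam :: "nat \<Rightarrow> nat \<Rightarrow> (nat \<Rightarrow> bool) \<Rightarrow> nat \<Rightarrow> nat \<Rightarrow> nat" where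
  "flip_fam i m b j = (if i \<le> j \<and> j \<le> i + m \<and> \<not> b (j - i) then Transposition.transpose 1 2 else id)"

lemma flip_fam_id_iff: "j \<le> m \<Longrightarrow> flip_fam i m b (i + j) = id \<longleftrightarrow> b j"
  by (auto simp: flip_fam_def fun_eq_iff Transposition.transpose_def)

text \<open>A node of the segment carries two variables and any other node none, so a family of
  permutations is one binary choice per node of the segment.\<close>

lemma bij_betw_flip_fam:
  assumes "1 \<le> i" "i + m \<le> n - 1"
  shows "bij_betw (flip_fam i m) ({..m} \<rightarrow>\<^sub>E UNIV) (perm_fams n (\<lambda>j. segtype i m j + segtype i m j))"
proof (rule bij_betwI[where g = "\<lambda>\<sigma>. \<lambda>j\<in>{..m}. \<sigma> (i + j) = id"])
  have "flip_fam i m b j permutes {1..segtype i m j + segtype i m j}" for b j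
  proof (cases "i \<le> j \<and> j \<le> i + m")
    case True
    then have "Transposition.transpose 1 2 permutes {1..segtype i m j + segtype i m j}"
      by (intro permutes_swap_id) (simp_all add: segtype_def)
    then show ?thesis by (simp add: flip_fam_def permutes_id)
  next
    case False
    then have "flip_fam i m b j = id" by (auto simp: flip_fam_def)
    then show ?thesis by (simp only: permutes_id)
  qed
  moreover have "flip_fam i m b j = id" if "j \<notin> {1..n - 1}" for b j
    using that assms by (auto simp: flip_fam_def)
  ultimately show "flip_fam i m \<in> ({..m} \<rightarrow>\<^sub>E UNIV) \<rightarrow> perm_fams n (\<lambda>j. segtype i m j + segtype i m j)"
    by (simp add: perm_fams_def)
  show "(\<lambda>\<sigma>. \<lambda>j\<in>{..m}. \<sigma> (i + j) = id) \<in> perm_fams n (\<lambda>j. segtype i m j + segtype i m j) \<rightarrow> ({..m} \<rightarrow>\<^sub>E UNIV)"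
    by (intro Pi_I restrict_PiE[THEN iffD2] UNIV_I)
  show "(\<lambda>j\<in>{..m}. flip_fam i m b (i + j) = id) = b" if "b \<in> {..m} \<rightarrow>\<^sub>E UNIV" for b
  proof
    fix j
    show "(\<lambda>j\<in>{..m}. flip_fam i m b (i + j) = id) j = b j"
    proof (cases "j \<le> m")
      case False
      then show ?thesis using PiE_arb[OF that, of j] by simp
    qed (simp add: flip_fam_id_iff)
  qed
  show "flip_fam i m (\<lambda>j\<in>{..m}. \<sigma> (i + j) = id) = \<sigma>"
    if "\<sigma> \<in> perm_fams n (\<lambda>j. segtype i m j + segtype i m j)" for \<sigma>
  proof
    fix j
    have seg: "\<sigma> j = id \<or> \<sigma> j = Transposition.transpose 1 2" if "i \<le> j" "j \<le> i + m"
    proof -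
      have "\<sigma> j permutes {1..segtype i m j + segtype i m j}"
        using \<open>\<sigma> \<in> _\<close> that assms by (simp add: perm_fams_def)
      moreover have "{1..segtype i m j + segtype i m j} = {1, 2}"
        using that by (auto simp: segtype_def)
      ultimately have "\<sigma> j permutes {1, 2}" by (simp only:)
      then show ?thesis by (simp only: permutes_doubleton_iff)
    qed
    have out: "\<sigma> j = id" if "\<not> (i \<le> j \<and> j \<le> i + m)"
    proof (cases "j \<in> {1..n - 1}")
      case True
      then have "\<sigma> j permutes {1..segtype i m j + segtype i m j}"
        using \<open>\<sigma> \<in> _\<close> by (simp add: perm_fams_def)
      then show ?thesis using that by (auto simp: segtype_def)
    next
      case False
      then show ?thesis using \<open>\<sigma> \<in> _\<close> by (simp add: perm_fams_def)
    qed
    show "flip_fam i m (\<lambda>j\<in>{..m}. \<sigma> (i + j) = id) j = \<sigma> j"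
    proof (cases "i \<le> j \<and> j \<le> i + m")
      case True
      then have "j - i \<le> m" "i + (j - i) = j" by auto
      then have "(\<lambda>j\<in>{..m}. \<sigma> (i + j) = id) (j - i) = (\<sigma> j = id)"
        by simp
      with True seg show ?thesis unfolding flip_fam_def by metis
    next
      case False
      then show ?thesis unfolding flip_fam_def out[OF False] by meson
    qed
  qed
qed

text \<open>For \<open>m = 0\<close> only the conventional values \<open>-1\<close> and
  \<open>0\<close> of \<open>kk\<close> are read, so both factors of the star product are the same
  function.\<close>

lemma fseg_0: "fseg x r \<delta> i 0 k = fseg x r \<delta> i 0 k'"
  by (simp add: fseg_def fun_eq_iff)

text \<open>The conventional values of \<open>kk\<close> enter only the two end factors. The
  interior factors see only differences of consecutive \<open>k\<close>, which a common shift by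
  \<open>p\<close> leaves unchanged.\<close>

lemma fseg_Suc:
  "fseg x r \<delta> i (Suc q) k W K =
    (\<Prod>j<Suc q. brk x r (W (i + j) 1 - W (i + Suc j) 1 - (k (Suc j) + 1/2) * \<delta>)
        / brk x r (W (i + j) 1 - W (i + Suc j) 1))
    * (brk x r (W i 1 + (k 1 + 1/2) * \<delta> - K i)
      * (\<Prod>j<q. brk x r (W (i + Suc j) 1 - (k (Suc j) - k (Suc (Suc j)) + 1/2) * \<delta> - K (i + Suc j)))
      * brk x r (W (i + Suc q) 1 - (k (Suc q) + 1/2) * \<delta> - K (i + Suc q)))"
proof -
  define kk where "kk = (\<lambda>j. if j = 0 then - 1 else if j = Suc q + 1 then 0 else k j)"
  define F where "F = (\<lambda>j. brk x r (W (i + j) 1 - (kk j - kk (j + 1) + 1/2) * \<delta> - K (i + j)))"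
  have "(\<Prod>j\<in>{0..Suc q}. F j) = (\<Prod>j<Suc q. F j) * F (Suc q)"
    by (simp add: atLeast0AtMost lessThan_Suc_atMost[symmetric] mult.commute)
  also have "(\<Prod>j<Suc q. F j) = F 0 * (\<Prod>j<q. F (Suc j))"
    by (rule prod.lessThan_Suc_shift)
  also have "F 0 = brk x r (W i 1 + (k 1 + 1/2) * \<delta> - K i)"
    by (simp add: F_def kk_def algebra_simps)
  also have "(\<Prod>j<q. F (Suc j)) =
      (\<Prod>j<q. brk x r (W (i + Suc j) 1 - (k (Suc j) - k (Suc (Suc j)) + 1/2) * \<delta> - K (i + Suc j)))"
    by (intro prod.cong refl) (simp add: F_def kk_def)
  also have "F (Suc q) = brk x r (W (i + Suc q) 1 - (k (Suc q) + 1/2) * \<delta> - K (i + Suc q))"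
    by (simp add: F_def kk_def)
  finally have F: "(\<Prod>j\<in>{0..Suc q}. F j) = brk x r (W i 1 + (k 1 + 1/2) * \<delta> - K i)
      * (\<Prod>j<q. brk x r (W (i + Suc j) 1 - (k (Suc j) - k (Suc (Suc j)) + 1/2) * \<delta> - K (i + Suc j)))
      * brk x r (W (i + Suc q) 1 - (k (Suc q) + 1/2) * \<delta> - K (i + Suc q))" .
  have G: "(\<Prod>j\<in>{1..Suc q}. brk x r (W (i + j - 1) 1 - W (i + j) 1 - (kk j + 1/2) * \<delta>)
        / brk x r (W (i + j - 1) 1 - W (i + j) 1))
    = (\<Prod>j<Suc q. brk x r (W (i + j) 1 - W (i + Suc j) 1 - (k (Suc j) + 1/2) * \<delta>)
        / brk x r (W (i + j) 1 - W (i + Suc j) 1))"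
    by (rule prod.reindex_bij_witness[of _ Suc "\<lambda>j. j - 1"]) (auto simp: kk_def)
  show ?thesis
    unfolding fseg_def Let_def kk_def[symmetric] F[unfolded F_def] G ..
qed

lemma star_term_fseg:
  fixes U V :: "nat \<Rightarrow> nat \<Rightarrow> complex" and i q :: nat and x :: real and r :: nat
  assumes "1 \<le> i" "i + Suc q \<le> n - 1"
  defines "f \<equiv> brk x r" and "u \<equiv> (\<lambda>j. U (i + j) 1)" and "v \<equiv> (\<lambda>j. V (i + j) 1)"
  shows "star_term n x r \<delta> (segtype i (Suc q)) (segtype i (Suc q)) (fseg x r \<delta> i (Suc q) k) (fseg x r \<delta> i (Suc q) k') U V \<kappa>
    = f (u 0 + (k 1 + 1/2) * \<delta> - (\<kappa> i - \<delta>)) * f (v 0 + (k' 1 + 1/2) * \<delta> - \<kappa> i)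
      * (\<Prod>j\<le>Suc q. f (u j - v j - \<delta>) / f (u j - v j))
      * (\<Prod>j<Suc q. f (u j - u (Suc j) - (k (Suc j) + 1/2) * \<delta>) * f (v j - v (Suc j) - (k' (Suc j) + 1/2) * \<delta>)
          * f (u j - v (Suc j) + \<delta> / 2) * f (u (Suc j) - v j + \<delta> / 2)
          / (f (u j - u (Suc j)) * f (v j - v (Suc j)) * f (u j - v (Suc j)) * f (u (Suc j) - v j)))
      * (\<Prod>j<q. f (u (Suc j) - (k (Suc j) - k (Suc (Suc j)) + 1/2) * \<delta> - \<kappa> (i + Suc j))
          * f (v (Suc j) - (k' (Suc j) - k' (Suc (Suc j)) + 1/2) * \<delta> - \<kappa> (i + Suc j)))
      * (f (u (Suc q) - (k (Suc q) + 1/2) * \<delta> - (\<kappa> (i + Suc q) - \<delta>)) * f (v (Suc q) - (k' (Suc q) + 1/2) * \<delta> - \<kappa> (i + Suc q)))"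
proof -
  let ?s = "segtype i (Suc q)"
  define K where "K = (\<lambda>j. if j \<in> {1..n-1}
               then \<kappa> j + (of_nat (bz n ?s (j - 1)) - 2 * of_nat (bz n ?s j) + of_nat (bz n ?s (j + 1))) * \<delta>
               else \<kappa> j)"
  \<comment> \<open>The segment lies in \<open>{1..n-1}\<close>, so its type already vanishes at 0
    and \<open>n\<close>.\<close>
  have bz: "bz n ?s j = ?s j" for j
    using assms by (auto simp: bz_def segtype_def)
  \<comment> \<open>The second difference of the indicator of the segment is -1 at its two ends and
    0 strictly inside.\<close>
  have K: "K i = \<kappa> i - \<delta>" "K (i + Suc q) = \<kappa> (i + Suc q) - \<delta>" 
    "\<And>j. j < q \<Longrightarrow> K (i + Suc j) = \<kappa> (i + Suc j)"
    using assms(1,2) unfolding K_def bz by (auto simp: segtype_def algebra_simps)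
  have 1: "(\<Prod>j\<in>{1..n-1}. \<Prod>c\<in>{1..?s j}. \<Prod>d\<in>{1..?s j}.
        f (U j c - V j d - \<delta>) / f (U j c - V j d)) = (\<Prod>j\<le>Suc q. f (u j - v j - \<delta>) / f (u j - v j))"
  proof -
    have "(\<Prod>j\<in>{1..n-1}. \<Prod>c\<in>{1..?s j}. \<Prod>d\<in>{1..?s j}. f (U j c - V j d - \<delta>) / f (U j c - V j d))
        = (\<Prod>j\<in>{1..n-1}. if i \<le> j \<and> j < i + Suc (Suc q) then f (U j 1 - V j 1 - \<delta>) / f (U j 1 - V j 1) else 1)"
      unfolding prod_segtype by (intro prod.cong refl) auto
    also have "\<dots> = (\<Prod>j<Suc (Suc q). f (u j - v j - \<delta>) / f (u j - v j))"
      unfolding u_def v_def using assms(1,2) by (intro prod_segment) auto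
    finally show ?thesis by (simp only: lessThan_Suc_atMost)
  qed
  have 2: "(\<Prod>j\<in>{1..n-2}. \<Prod>c\<in>{1..?s j}. \<Prod>d\<in>{1..?s (j + 1)}.
        f (U j c - V (j + 1) d + \<delta> / 2) / f (U j c - V (j + 1) d))
      = (\<Prod>j<Suc q. f (u j - v (Suc j) + \<delta> / 2) / f (u j - v (Suc j)))"
  proof -
    have "(\<Prod>j\<in>{1..n-2}. \<Prod>c\<in>{1..?s j}. \<Prod>d\<in>{1..?s (j + 1)}. f (U j c - V (j + 1) d + \<delta> / 2) / f (U j c - V (j + 1) d))
        = (\<Prod>j\<in>{1..n-2}. if i \<le> j \<and> j < i + Suc q then f (U j 1 - V (j + 1) 1 + \<delta> / 2) / f (U j 1 - V (j + 1) 1) else 1)"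
      unfolding prod_segtype by (intro prod.cong refl) auto
    also have "\<dots> = (\<Prod>j<Suc q. f (U (i + j) 1 - V (i + j + 1) 1 + \<delta> / 2) / f (U (i + j) 1 - V (i + j + 1) 1))"
      using assms(1,2) by (intro prod_segment) auto
    finally show ?thesis by (simp add: u_def v_def del: prod.lessThan_Suc)
  qed
  have 3: "(\<Prod>j\<in>{2..n-1}. \<Prod>c\<in>{1..?s j}. \<Prod>d\<in>{1..?s (j - 1)}.
        f (U j c - V (j - 1) d + \<delta> / 2) / f (U j c - V (j - 1) d))
      = (\<Prod>j<Suc q. f (u (Suc j) - v j + \<delta> / 2) / f (u (Suc j) - v j))"
  proof -
    have "(\<Prod>j\<in>{2..n-1}. \<Prod>c\<in>{1..?s j}. \<Prod>d\<in>{1..?s (j - 1)}. f (U j c - V (j - 1) d + \<delta> / 2) / f (U j c - V (j - 1) d))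
        = (\<Prod>j\<in>{2..n-1}. if Suc i \<le> j \<and> j < Suc i + Suc q then f (U j 1 - V (j - 1) 1 + \<delta> / 2) / f (U j 1 - V (j - 1) 1) else 1)"
      unfolding prod_segtype by (intro prod.cong refl) auto
    also have "\<dots> = (\<Prod>j<Suc q. f (U (Suc i + j) 1 - V (Suc i + j - 1) 1 + \<delta> / 2) / f (U (Suc i + j) 1 - V (Suc i + j - 1) 1))"
      using assms(1,2) by (intro prod_segment) auto
    finally show ?thesis by (simp add: u_def v_def del: prod.lessThan_Suc)
  qed
  have int: "(\<Prod>j<q. f (u (Suc j) - (k (Suc j) - k (Suc (Suc j)) + 1/2) * \<delta> - K (i + Suc j)))
      = (\<Prod>j<q. f (u (Suc j) - (k (Suc j) - k (Suc (Suc j)) + 1/2) * \<delta> - \<kappa> (i + Suc j)))"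
    by (intro prod.cong refl) (simp add: K(3) del: add_Suc_right)
  have u0: "U i 1 = u 0" "\<And>j. U (i + j) 1 = u j" "V i 1 = v 0" "\<And>j. V (i + j) 1 = v j"
    by (simp_all add: u_def v_def)
  show ?thesis
    unfolding star_term_def K_def[symmetric] fseg_Suc f_def[symmetric] 1 2 3
    unfolding u0 int K(1,2) prod.distrib prod_dividef
    by (simp only: times_divide_eq_left times_divide_eq_right divide_divide_eq_left mult_ac)
qed

lemma star_fseg:
  assumes "1 \<le> i" "i + m \<le> n - 1"
  shows "star n x r \<delta> (segtype i m) (segtype i m) (fseg x r \<delta> i m k) (fseg x r \<delta> i m k') w \<kappa>
    = 1 / of_nat (\<Prod>j\<in>{1..n-1}. fact (segtype i m j + segtype i m j))
      * (\<Sum>b\<in>({..m} \<rightarrow>\<^sub>E UNIV). star_term n x r \<delta> (segtype i m) (segtype i m) (fseg x r \<delta> i m k) (fseg x r \<delta> i m k')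
          (\<lambda>j c. w j (flip_fam i m b j c)) (\<lambda>j d. w j (flip_fam i m b j (segtype i m j + d))) \<kappa>)"
  unfolding star_def
  by (subst sum.reindex_bij_betw[OF bij_betw_flip_fam[OF assms], symmetric]) (rule refl)

section \<open>Identification of the star product with the chain\<close>

context chain
begin

definition denom :: "nat \<Rightarrow> bool \<Rightarrow> bool \<Rightarrow> complex" where
  "denom j b e = f (X j b - X (Suc j) e) * f (X j (\<not> b) - X (Suc j) (\<not> e))
      * f (X j b - X (Suc j) (\<not> e)) * f (X (Suc j) e - X j (\<not> b))"

text \<open>Flipping one state permutes the four factors with two changes of sign, so the
  denominators can be absorbed into the constants \<open>s\<close>.\<close>

lemma denom_const: "denom j b e = denom j True True"
  using odd_diff[of "X (Suc j) True" "X j True"] odd_diff[of "X (Suc j) True" "X j False"]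
    odd_diff[of "X (Suc j) False" "X j True"] odd_diff[of "X (Suc j) False" "X j False"]
  by (cases b; cases e) (simp_all add: denom_def)

text \<open>Both variables of an interior node meet the same shift, whichever factor they enter; the
  product is therefore a constant of the chain.\<close>

definition interior :: "(nat \<Rightarrow> complex) \<Rightarrow> (nat \<Rightarrow> complex) \<Rightarrow> nat \<Rightarrow> complex" where
  "interior k \<kappa> j = f (X (Suc j) True - (k (Suc j) - k (Suc (Suc j)) + 1/2) * \<delta> - \<kappa> (Suc j))
      * f (X (Suc j) False - (k (Suc j) - k (Suc (Suc j)) + 1/2) * \<delta> - \<kappa> (Suc j))"

end

text \<open>\<open>e\<close> and \<open>e'\<close> are the amounts added to \<open>k\<close> in the
  first and second factor, so that one statement serves both orders of multiplication. With
  \<open>q\<close> interior nodes and \<open>q + 1\<close> links, the interior constant of node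
  \<open>j + 1\<close> is attached to link \<open>j\<close>, and the last link gets none.\<close>

lemma star_term_chain:
  fixes i q :: nat and w :: "nat \<Rightarrow> nat \<Rightarrow> complex" and \<delta> e e' :: complex and k \<kappa> :: "nat \<Rightarrow> complex"
  assumes "chain (brk x r) H T X"
  assumes i: "1 \<le> i" "i + Suc q \<le> n - 1"
    and X: "\<And>j b. j \<le> Suc q \<Longrightarrow> X j b = w (i + j) (if b then 1 else 2)"
  defines "f \<equiv> brk x r" and "A \<equiv> \<kappa> i - (k 1 + 1/2) * \<delta>" and "B \<equiv> \<kappa> (i + Suc q) + (k (Suc q) + 1/2) * \<delta>"
    and "c \<equiv> (\<lambda>j. (k (Suc j) + 1/2) * \<delta>)"
    and "s \<equiv> (\<lambda>j. (if j < q then chain.interior (brk x r) X \<delta> k (\<lambda>j. \<kappa> (i + j)) j else 1)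
                    / chain.denom (brk x r) X j True True)"
  shows "star_term n x r \<delta> (segtype i (Suc q)) (segtype i (Suc q))
      (fseg x r \<delta> i (Suc q) (\<lambda>j. k j + e)) (fseg x r \<delta> i (Suc q) (\<lambda>j. k j + e'))
      (\<lambda>j c. w j (flip_fam i (Suc q) b j c)) (\<lambda>j d. w j (flip_fam i (Suc q) b j (segtype i (Suc q) j + d))) \<kappa>
    = f (X 0 (b 0) - A + e * \<delta> + \<delta>) * f (X 0 (\<not> b 0) - A + e' * \<delta>)
      * (\<Prod>j\<le>Suc q. chain.site (brk x r) X \<delta> j (b j))
      * (\<Prod>j<Suc q. s j * chain.link (brk x r) X \<delta> j (c j + e * \<delta>) (c j + e' * \<delta>) (b j) (b (Suc j)))
      * (f (X (Suc q) (b (Suc q)) - B - e * \<delta> + \<delta>) * f (X (Suc q) (\<not> b (Suc q)) - B - e' * \<delta>))"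
proof -
  interpret chain "brk x r" H T X \<delta> by fact
  define U V where "U = (\<lambda>j c. w j (flip_fam i (Suc q) b j c))"
    and "V = (\<lambda>j d. w j (flip_fam i (Suc q) b j (segtype i (Suc q) j + d)))"
  have u: "U (i + j) 1 = X j (b j)" and v: "V (i + j) 1 = X j (\<not> b j)" if "j \<le> Suc q" for j
    using that by (auto simp: U_def V_def X flip_fam_def segtype_def numeral_2_eq_2)
  have site: "(\<Prod>j\<le>Suc q. f (U (i + j) 1 - V (i + j) 1 - \<delta>) / f (U (i + j) 1 - V (i + j) 1))
      = (\<Prod>j\<le>Suc q. site j (b j))"
    by (intro prod.cong refl) (simp only: atMost_iff u v site_def gap_def f_def)
  have int: "(\<Prod>j<q. f (U (i + Suc j) 1 - (k (Suc j) + e - (k (Suc (Suc j)) + e) + 1/2) * \<delta> - \<kappa> (i + Suc j))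
          * f (V (i + Suc j) 1 - (k (Suc j) + e' - (k (Suc (Suc j)) + e') + 1/2) * \<delta> - \<kappa> (i + Suc j)))
      = (\<Prod>j<q. interior k (\<lambda>j. \<kappa> (i + j)) j)"
  proof (intro prod.cong refl)
    fix j assume "j \<in> {..<q}"
    then have "Suc j \<le> Suc q" by simp
    then show "f (U (i + Suc j) 1 - (k (Suc j) + e - (k (Suc (Suc j)) + e) + 1/2) * \<delta> - \<kappa> (i + Suc j))
          * f (V (i + Suc j) 1 - (k (Suc j) + e' - (k (Suc (Suc j)) + e') + 1/2) * \<delta> - \<kappa> (i + Suc j))
        = interior k (\<lambda>j. \<kappa> (i + j)) j"
      unfolding u[OF \<open>Suc j \<le> Suc q\<close>] v[OF \<open>Suc j \<le> Suc q\<close>]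
      by (cases "b (Suc j)") (simp_all add: interior_def f_def del: add_Suc_right)
  qed
  have link: "(\<Prod>j<Suc q. f (U (i + j) 1 - U (i + Suc j) 1 - (k (Suc j) + e + 1/2) * \<delta>)
          * f (V (i + j) 1 - V (i + Suc j) 1 - (k (Suc j) + e' + 1/2) * \<delta>)
          * f (U (i + j) 1 - V (i + Suc j) 1 + \<delta> / 2) * f (U (i + Suc j) 1 - V (i + j) 1 + \<delta> / 2)
          / (f (U (i + j) 1 - U (i + Suc j) 1) * f (V (i + j) 1 - V (i + Suc j) 1)
             * f (U (i + j) 1 - V (i + Suc j) 1) * f (U (i + Suc j) 1 - V (i + j) 1)))
      = (\<Prod>j<Suc q. link j (c j + e * \<delta>) (c j + e' * \<delta>) (b j) (b (Suc j)) / denom j True True)"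
  proof (intro prod.cong refl)
    fix j assume "j \<in> {..<Suc q}"
    then have j: "j \<le> Suc q" "Suc j \<le> Suc q" by auto
    have k: "(k (Suc j) + e + 1/2) * \<delta> = c j + e * \<delta>" for e by (simp add: c_def algebra_simps)
    show "f (U (i + j) 1 - U (i + Suc j) 1 - (k (Suc j) + e + 1/2) * \<delta>)
          * f (V (i + j) 1 - V (i + Suc j) 1 - (k (Suc j) + e' + 1/2) * \<delta>)
          * f (U (i + j) 1 - V (i + Suc j) 1 + \<delta> / 2) * f (U (i + Suc j) 1 - V (i + j) 1 + \<delta> / 2)
          / (f (U (i + j) 1 - U (i + Suc j) 1) * f (V (i + j) 1 - V (i + Suc j) 1)
             * f (U (i + j) 1 - V (i + Suc j) 1) * f (U (i + Suc j) 1 - V (i + j) 1))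
        = link j (c j + e * \<delta>) (c j + e' * \<delta>) (b j) (b (Suc j)) / denom j True True"
      unfolding denom_const[of j "b j" "b (Suc j)", symmetric]
      unfolding denom_def link_def u[OF j(1)] u[OF j(2)] v[OF j(1)] v[OF j(2)] k f_def ..
  qed
  have s: "(\<Prod>j<Suc q. s j * g j) = (\<Prod>j<Suc q. g j / denom j True True) * (\<Prod>j<q. interior k (\<lambda>j. \<kappa> (i + j)) j)" for g
    unfolding s_def by (simp add: prod.distrib prod_dividef)
  have ends: "X 0 (b 0) + (k 1 + e + 1/2) * \<delta> - (\<kappa> i - \<delta>) = X 0 (b 0) - A + e * \<delta> + \<delta>"
    "X 0 (\<not> b 0) + (k 1 + e' + 1/2) * \<delta> - \<kappa> i = X 0 (\<not> b 0) - A + e' * \<delta>"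
    "X (Suc q) (b (Suc q)) - (k (Suc q) + e + 1/2) * \<delta> - (\<kappa> (i + Suc q) - \<delta>) = X (Suc q) (b (Suc q)) - B - e * \<delta> + \<delta>"
    "X (Suc q) (\<not> b (Suc q)) - (k (Suc q) + e' + 1/2) * \<delta> - \<kappa> (i + Suc q) = X (Suc q) (\<not> b (Suc q)) - B - e' * \<delta>"
    by (simp_all add: A_def B_def algebra_simps del: add_Suc_right)
  show ?thesis
    unfolding U_def[symmetric] V_def[symmetric] star_term_fseg[OF i]
    unfolding site[unfolded f_def] link[unfolded f_def] int[unfolded f_def] s f_def
    unfolding u[OF le0] v[OF le0] u[OF order_refl] v[OF order_refl] ends
    by (simp only: mult_ac)
qed

section \<open>Commutativity\<close>

text \<open>If \<open>D z \<noteq> 0\<close>, then \<open>h\<close> vanishes on a nonempty open set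
  and hence everywhere, contradicting its value at \<open>z\<^sub>1\<close>.\<close>

lemma continuous_zero_off_holomorphic_zeros:
  fixes D h :: "complex \<Rightarrow> complex"
  assumes D: "continuous_on UNIV D" and h: "h holomorphic_on UNIV" "h z\<^sub>1 \<noteq> 0"
    and 0: "\<And>z. h z \<noteq> 0 \<Longrightarrow> D z = 0"
  shows "D z = 0"
proof (rule ccontr)
  assume "D z \<noteq> 0"
  have "open {z. D z \<noteq> 0}"
    using D by (intro open_Collect_neq continuous_on_const)
  then have "h z\<^sub>1 = 0"
    by (rule analytic_continuation_open[of _ UNIV h "\<lambda>_. 0"]) (use h 0 \<open>D z \<noteq> 0\<close> in auto)
  with h(2) show False ..
qed

text \<open>The identity of meromorphic functions is asserted pointwise; \<open>generic\<close>
  keeps every denominator of both sides away from zero.\<close>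

theorem theoremB1:
  fixes n r i m :: nat and x :: real and \<delta> p :: complex and k :: "nat \<Rightarrow> complex"
    and w :: "nat \<Rightarrow> nat \<Rightarrow> complex" and \<kappa> :: "nat \<Rightarrow> complex"
  assumes "n \<ge> 2" and "r > 0" and "0 < x" and "x < 1"
    and "1 \<le> i" and "i + m \<le> n - 1"
    and generic: "\<And>j j' s t. j \<in> {i..i+m} \<Longrightarrow> j' \<in> {i..i+m} \<Longrightarrow> s \<in> {1,2} \<Longrightarrow> t \<in> {1,2} \<Longrightarrow>
                   (j, s) \<noteq> (j', t) \<Longrightarrow> brk x r (w j s - w j' t) \<noteq> 0"
  shows "star n x r \<delta> (segtype i m) (segtype i m)
           (fseg x r \<delta> i m k) (fseg x r \<delta> i m (\<lambda>j. k j + p)) w \<kappa>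
       = star n x r \<delta> (segtype i m) (segtype i m)
           (fseg x r \<delta> i m (\<lambda>j. k j + p)) (fseg x r \<delta> i m k) w \<kappa>"
proof (cases m)
  case 0
  then show ?thesis using fseg_0[of x r \<delta> i k "\<lambda>j. k j + p"] by simp
next
  case (Suc q)
  note x = assms(3,4,2)
  define f where "f = brk x r"
  obtain H T where HT: "\<And>a b. f (a + b) * f (a - b) = H a * T b - T a * H b"
    using brk_addition[OF x] unfolding f_def by blast
  \<comment> \<open>The values beyond \<open>m\<close> only serve to satisfy the nonvanishing assumption of the locale.\<close>
  define X where "X = (\<lambda>j b. if j \<le> m then w (i + j) (if b then 1 else 2) else if b then 1 / 2 else 0)"
  have "f (X j True - X j False) \<noteq> 0" for j
    using generic[of "i + j" "i + j" 1 2] brk_nonzero[OF x] by (auto simp: X_def f_def)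
  then have chain: "chain f H T X"
    using HT by unfold_locales
  then interpret chain f H T X \<delta> .
  define A B where "A = \<kappa> i - (k 1 + 1/2) * \<delta>" and "B = \<kappa> (i + m) + (k m + 1/2) * \<delta>"
  define c s where "c = (\<lambda>j. (k (Suc j) + 1/2) * \<delta>)"
    and "s = (\<lambda>j. (if j < q then interior k (\<lambda>j. \<kappa> (i + j)) j else 1) / denom j True True)"
  define Z where "Z = (\<lambda>e e'. \<Sum>b\<in>({..m} \<rightarrow>\<^sub>E UNIV). f (X 0 (b 0) - A + e * \<delta> + \<delta>) * f (X 0 (\<not> b 0) - A + e' * \<delta>)
      * (\<Prod>j\<le>m. site j (b j))
      * (\<Prod>j<m. s j * link j (c j + e * \<delta>) (c j + e' * \<delta>) (b j) (b (Suc j)))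
      * (f (X m (b m) - B - e * \<delta> + \<delta>) * f (X m (\<not> b m) - B - e' * \<delta>)))"
  have Xw: "X j b = w (i + j) (if b then 1 else 2)" if "j \<le> Suc q" for j b
    using that by (simp add: X_def Suc)
  have star: "star n x r \<delta> (segtype i m) (segtype i m)
           (fseg x r \<delta> i m (\<lambda>j. k j + e)) (fseg x r \<delta> i m (\<lambda>j. k j + e')) w \<kappa>
        = 1 / of_nat (\<Prod>j\<in>{1..n-1}. fact (segtype i m j + segtype i m j)) * Z e e'" for e e'
    unfolding star_fseg[OF assms(5,6)] unfolding Z_def Suc A_def B_def c_def s_def f_def
    by (subst star_term_chain[OF chain[unfolded f_def] assms(5) assms(6)[unfolded Suc] Xw]) (assumption | rule refl)+
  have fh: "f holomorphic_on UNIV" unfolding f_def by (rule holomorphic_brk[OF x])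
  have fc: "continuous_on UNIV (\<lambda>z. f (g z))" if "continuous_on UNIV g" for g :: "complex \<Rightarrow> complex"
    using continuous_on_compose2[OF holomorphic_on_imp_continuous_on[OF fh] that] by simp
  have "Z 0 p - Z p 0 = 0"
  \<comment> \<open>For \<open>\<delta> = 0\<close> the function \<open>h\<close> below would be
    constantly \<open>f 0 = 0\<close>; but \<open>e\<close> and \<open>e'\<close> enter
    \<open>Z\<close> only multiplied by \<open>\<delta>\<close>, so both terms agree.\<close>
  proof (cases "\<delta> = 0")
    case False
    show ?thesis
    \<comment> \<open>The witness solves \<open>\<delta> - z * \<delta> = 1 / 2\<close>, the point
      where \<open>brk_nonzero\<close> applies.\<close>
    proof (rule continuous_zero_off_holomorphic_zeros[where D = "\<lambda>p. Z 0 p - Z p 0"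
          and h = "\<lambda>p. f (\<delta> - p * \<delta>)" and z\<^sub>1 = "1 - 1 / (2 * \<delta>)"])
      show "continuous_on UNIV (\<lambda>p. Z 0 p - Z p 0)"
        unfolding Z_def link_def by (intro continuous_intros fc)
      show "(\<lambda>p. f (\<delta> - p * \<delta>)) holomorphic_on UNIV"
      proof -
        have "(\<lambda>p. \<delta> - p * \<delta>) holomorphic_on UNIV" by (intro holomorphic_intros)
        from holomorphic_on_compose_gen[OF this fh] show ?thesis by (simp add: o_def)
      qed
      show "f (\<delta> - (1 - 1 / (2 * \<delta>)) * \<delta>) \<noteq> 0"
        using brk_nonzero[OF x] False by (simp add: f_def algebra_simps)
      show "Z 0 p - Z p 0 = 0" if "f (\<delta> - p * \<delta>) \<noteq> 0" for p
        \<comment> \<open>Here \<open>l = p * \<delta>\<close>: the two sides of the exchange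
          relation are \<open>Z 0 p\<close> and \<open>Z p 0\<close>.\<close>
        using chain_exchange[OF that, of A m s c B] by (simp add: Z_def mult.assoc)
    qed
  qed (simp add: Z_def)
  then show ?thesis
    using star[of 0 p] star[of p 0] by simp
qed

end
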